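(* There is a polynomial-time algorithm that, given an instance $(T,k)$ of \textsc{Feedback Arc Set in Tournaments} (\textsc{$k$-FAST}), outputs an equivalent instance $(T',k')$ of \textsc{$k$-FAST} with $k'\le k$ in which $T'$ has at most $4k$ vertices. That is, \textsc{$k$-FAST} admits a kernel with at most $4k$ vertices that can be computed in polynomial time.
   Context: A tournament $T=(V,A)$ is an orientation of a complete graph. \textsc{$k$-FAST}: given a tournament $T$ and an integer $k$, decide whether there is a set of at most $k$ arcs whose reversal makes $T$ acyclic; equivalently, whether there is a linear ordering $v_1,\dots,v_n$ of $V$ with at most $k$ backward arcs (arcs $v_iv_j$ with $i>j$). Two instances are equivalent if one is a yes-instance iff the other is. *)

theory Defs
  imports "HOL-Computational_Algebra.Polynomial"
begin

section \<open>Feedback arc set in tournaments\<close>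

definition tournament :: "'v set \<Rightarrow> ('v \<times> 'v) set \<Rightarrow> bool" where
  "tournament V A \<longleftrightarrow>
     finite V \<and> A \<subseteq> V \<times> V \<and> irrefl A \<and>
     (\<forall>u\<in>V. \<forall>v\<in>V. u \<noteq> v \<longrightarrow> ((u, v) \<in> A) \<noteq> ((v, u) \<in> A))"

definition reverse_arcs :: "('v \<times> 'v) set \<Rightarrow> ('v \<times> 'v) set \<Rightarrow> ('v \<times> 'v) set" where
  "reverse_arcs F A = (A - F) \<union> F\<inverse>"

text \<open>
  The budget is an integer, and an instance with a negative budget is a no-instance. Such budgets
  are needed: a kernel with at most \<open>4 * k\<close> vertices is empty for \<open>k = 0\<close>, and the empty
  tournament is a no-instance only for a negative budget.
\<close>

definition fast :: "('v \<times> 'v) set \<Rightarrow> int \<Rightarrow> bool" where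
  "fast A k \<longleftrightarrow>
     (\<exists>F. F \<subseteq> A \<and> finite F \<and> int (card F) \<le> k \<and> acyclic (reverse_arcs F A))"


section \<open>Model of computation\<close>

text \<open>
  Structured programs over binary trees, a variable-free form of Jones's WHILE language.
  A program transforms one tree into another. Every step is charged the full
  size of the trees it reads, copies or builds, so that duplicating data is never free and
  a run of cost \<open>t\<close> only produces trees of size at most \<open>t\<close>. With this cost measure the model and
  Turing machines simulate each other with polynomial overhead.
\<close>

datatype tree = Leaf | Node tree tree

primrec tsize :: "tree \<Rightarrow> nat" where
  "tsize Leaf = 1"
| "tsize (Node l r) = Suc (tsize l + tsize r)"

primrec left :: "tree \<Rightarrow> tree" where
  "left Leaf = Leaf"
| "left (Node l r) = l"

primrec right :: "tree \<Rightarrow> tree" where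
  "right Leaf = Leaf"
| "right (Node l r) = r"

datatype prog =
    Skip
  | MkLeaf
  | Left
  | Right
  | MkNode prog prog
  | Seq prog prog
  | Cond prog prog prog
  | While prog prog

text \<open>
  \<open>run p x y t\<close>: program \<open>p\<close> started on \<open>x\<close> halts with result \<open>y\<close> at cost \<open>t\<close>.
  Both branches of \<open>MkNode\<close> are run on a copy of the input, and so is the guard
  of \<open>Cond\<close> and \<open>While\<close>; a guard holds iff its result is not \<open>Leaf\<close>.
\<close>

inductive run :: "prog \<Rightarrow> tree \<Rightarrow> tree \<Rightarrow> nat \<Rightarrow> bool" where
  Skip: "run Skip x x (tsize x)"
| MkLeaf: "run MkLeaf x Leaf (tsize x)"
| Left: "run Left x (left x) (tsize x)"
| Right: "run Right x (right x) (tsize x)"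
| MkNode: "run p x y s \<Longrightarrow> run q x z t \<Longrightarrow>
    run (MkNode p q) x (Node y z) (s + t + tsize x + tsize (Node y z))"
| Seq: "run p x y s \<Longrightarrow> run q y z t \<Longrightarrow> run (Seq p q) x z (s + t + 1)"
| CondTrue: "run b x g r \<Longrightarrow> g \<noteq> Leaf \<Longrightarrow> run p x y s \<Longrightarrow>
    run (Cond b p q) x y (r + s + tsize x)"
| CondFalse: "run b x Leaf r \<Longrightarrow> run q x y s \<Longrightarrow>
    run (Cond b p q) x y (r + s + tsize x)"
| WhileTrue: "run b x g r \<Longrightarrow> g \<noteq> Leaf \<Longrightarrow> run p x y s \<Longrightarrow> run (While b p) y z t \<Longrightarrow>
    run (While b p) x z (r + s + t + tsize x)"
| WhileFalse: "run b x Leaf r \<Longrightarrow> run (While b p) x x (r + tsize x)"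

inductive_cases run_elims:
  "run Skip x y t" "run MkLeaf x y t" "run Left x y t" "run Right x y t"
  "run (MkNode p q) x y t" "run (Seq p q) x y t" "run (Cond b p q) x y t"
  "run (While b p) x y t"

lemma run_deterministic:
  "run p x y t \<Longrightarrow> run p x y' t' \<Longrightarrow> y = y' \<and> t = t'"
proof (induction arbitrary: y' t' rule: run.induct)
  case MkNode
  from MkNode.prems show ?case
    by (rule run_elims(5)) (auto dest!: MkNode.IH)
next
  case Seq
  from Seq.prems show ?case
    by (rule run_elims(6)) (auto dest!: Seq.IH)
next
  case CondTrue
  from CondTrue.prems show ?case
    by (rule run_elims(7)) (use CondTrue.hyps in \<open>auto dest!: CondTrue.IH\<close>)
next
  case CondFalse
  from CondFalse.prems show ?case
    by (rule run_elims(7)) (auto dest!: CondFalse.IH)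
next
  case WhileTrue
  from WhileTrue.prems show ?case
    by (rule run_elims(8)) (use WhileTrue.hyps in \<open>auto dest!: WhileTrue.IH\<close>)
next
  case WhileFalse
  from WhileFalse.prems show ?case
    by (rule run_elims(8)) (auto dest!: WhileFalse.IH)
qed (auto elim: run_elims)

lemma run_size_le: "run p x y t \<Longrightarrow> tsize y \<le> t"
proof (induction rule: run.induct)
  case (Left x)
  show ?case by (cases x) auto
next
  case (Right x)
  show ?case by (cases x) auto
next
  case (MkLeaf x)
  show ?case by (cases x) auto
qed auto


section \<open>Encoding of instances\<close>

definition enc_bool :: "bool \<Rightarrow> tree" where
  "enc_bool b = (if b then Node Leaf Leaf else Leaf)"

primrec enc_list :: "('a \<Rightarrow> tree) \<Rightarrow> 'a list \<Rightarrow> tree" where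
  "enc_list e [] = Leaf"
| "enc_list e (x # xs) = Node (e x) (enc_list e xs)"

text \<open>Binary digits, least significant first.\<close>

fun binary :: "nat \<Rightarrow> bool list" where
  "binary n = (if n = 0 then [] else odd n # binary (n div 2))"

declare binary.simps [simp del]

definition enc_int :: "int \<Rightarrow> tree" where
  "enc_int k = Node (enc_bool (k < 0)) (enc_list enc_bool (binary (nat \<bar>k\<bar>)))"

definition adjacency_matrix :: "nat \<Rightarrow> (nat \<times> nat) set \<Rightarrow> bool list list" where
  "adjacency_matrix n A = map (\<lambda>i. map (\<lambda>j. (i, j) \<in> A) [0..<n]) [0..<n]"

text \<open>
  An instance consists of a tournament with vertex set \<open>{..<n}\<close> and arc set \<open>A\<close>, given by its
  adjacency matrix, and of the budget \<open>k\<close>, given in signed binary notation.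
\<close>

definition enc_instance :: "nat \<Rightarrow> (nat \<times> nat) set \<Rightarrow> int \<Rightarrow> tree" where
  "enc_instance n A k = Node (enc_list (enc_list enc_bool) (adjacency_matrix n A)) (enc_int k)"

lemma enc_bool_inject: "enc_bool a = enc_bool b \<longleftrightarrow> a = b"
  by (auto simp: enc_bool_def)

lemma enc_list_inject:
  assumes "\<And>x y. e x = e y \<longleftrightarrow> x = y"
  shows "enc_list e xs = enc_list e ys \<longleftrightarrow> xs = ys"
proof (induction xs arbitrary: ys)
  case Nil
  show ?case by (cases ys) auto
next
  case (Cons x xs)
  then show ?case by (cases ys) (auto simp: assms)
qed

lemmas enc_bools_inject = enc_list_inject [of enc_bool, OF enc_bool_inject]
lemmas enc_matrix_inject = enc_list_inject [of "enc_list enc_bool", OF enc_bools_inject]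

lemma binary_inject: "binary m = binary n \<longleftrightarrow> m = n"
proof -
  have "foldr (\<lambda>b r. of_bool b + 2 * r) (binary n) 0 = n" for n
  proof (induction n rule: binary.induct)
    case (1 n)
    have "of_bool (odd n) + 2 * (n div 2) = n"
      by (simp add: mod_2_eq_odd [symmetric])
    with 1 show ?case
      by (subst binary.simps) simp
  qed
  then show ?thesis by metis
qed

lemma enc_int_inject: "enc_int k = enc_int l \<longleftrightarrow> k = l"
  by (auto simp: enc_int_def enc_bool_inject enc_bools_inject binary_inject)

lemma enc_instance_inject:
  assumes "tournament {..<n} A" "tournament {..<m} B"
  shows "enc_instance n A k = enc_instance m B l \<longleftrightarrow> n = m \<and> A = B \<and> k = l"
proof
  assume eq: "enc_instance n A k = enc_instance m B l"
  then have mat: "adjacency_matrix n A = adjacency_matrix m B" and kl: "k = l"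
    by (simp_all add: enc_instance_def enc_int_inject enc_matrix_inject)
  have "length (adjacency_matrix n A) = length (adjacency_matrix m B)"
    using mat by (rule arg_cong)
  then have nm: "n = m" by (simp add: adjacency_matrix_def)
  have "(i, j) \<in> A \<longleftrightarrow> (i, j) \<in> B" if "i < n" "j < n" for i j
  proof -
    have "adjacency_matrix n A ! i ! j = adjacency_matrix m B ! i ! j"
      using mat by simp
    then show ?thesis using that nm by (simp add: adjacency_matrix_def)
  qed
  moreover have "A \<subseteq> {..<n} \<times> {..<n}" "B \<subseteq> {..<n} \<times> {..<n}"
    using assms nm by (auto simp: tournament_def)
  ultimately have "A = B" by auto
  with nm kl show "n = m \<and> A = B \<and> k = l" by simp
qed simp

end

theory Submission
  imports Defs
begin

text \<open>
  Take a maximal set \<open>C\<close> of arc-disjoint triangles and let \<open>U\<close> be the set of vertices not covered by \<open>C\<close>;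
  by maximality no triangle has two vertices in \<open>U\<close>. Compute a maximum matching between the vertices
  of \<open>U\<close> and the arcs with which they form triangles. Both \<open>C\<close> and the matching consist of arc-disjoint
  triangles, so on a yes-instance each has at most \<open>k\<close> members, and the tournament induced by the covered
  and the matched vertices has at most \<open>4 * k\<close> vertices. It is equivalent with the same budget: by
  a Koenig-type argument the discarded vertices lie in a set \<open>W\<close> of vertices of \<open>U\<close> such that all arcs
  forming triangles with \<open>W\<close> are matched into \<open>W\<close>. The matching triangles of these arcs survive
  in the kernel and certify that reversing exactly these arcs is optimal among the arcs between
  different positions with respect to \<open>W\<close>.

  The matching is found by an auction, which needs no search for augmenting paths.
\<close>

section \<open>Polynomial-time functions between encoded types\<close>

text \<open>The constant 4 is 3 + 1: a member of \<open>C\<close> covers at most three vertices, and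
  each matched arc adds one vertex of \<open>U\<close>. Matched triangles are arc-disjoint because a
  triangle has at most one vertex in \<open>U\<close>: the matched arc avoids \<open>U\<close>, and
  the other two arcs meet at the matched vertex. A matched triangle may well share arcs with
  \<open>C\<close>; each family is compared with \<open>k\<close> on its own. The set
  \<open>W\<close> is never computed and enters only the proof of equivalence. The obstacle is the
  running time, which is to be proved for an actual program on trees. A polynomial-time step can be
  iterated safely only if all intermediate states stay polynomially small, so the algorithm is made
  of folds whose states have an evident size bound. This is what favours the auction: a single
  simple step, a state of fixed shape, and a potential that bounds the number of rounds.\<close>

lemma poly_nat_mono: "a \<le> b \<Longrightarrow> poly (q :: nat poly) a \<le> poly q b"
  by (induction q) (auto intro!: add_mono mult_mono)

text \<open>Costs are estimated by arbitrary expressions \<open>m\<close>, shown to be polynomial by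
  closure rules; this avoids assembling explicit polynomials.\<close>

definition pbounded :: "('a \<Rightarrow> tree) \<Rightarrow> ('a \<Rightarrow> nat) \<Rightarrow> bool" where
  "pbounded c m \<longleftrightarrow> (\<exists>q :: nat poly. \<forall>x. m x \<le> poly q (tsize (c x)))"

text \<open>One program and one polynomial serve all values of the type. The functions below must
  therefore be total and fast on malformed data too, such as ragged matrices.\<close>

definition ptime :: "('a \<Rightarrow> tree) \<Rightarrow> ('b \<Rightarrow> tree) \<Rightarrow> ('a \<Rightarrow> 'b) \<Rightarrow> bool" where
  "ptime c e f \<longleftrightarrow> (\<exists>p q. \<forall>x. \<exists>t. run p (c x) (e (f x)) t \<and> t \<le> poly q (tsize (c x)))"

lemma pbounded_const: "pbounded c (\<lambda>x. k)"
  unfolding pbounded_def by (rule exI [of _ "[:k:]"]) simp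

lemma pbounded_size: "pbounded c (\<lambda>x. tsize (c x))"
  unfolding pbounded_def by (rule exI [of _ "[:0, 1:]"]) simp

lemma pbounded_add: "pbounded c m \<Longrightarrow> pbounded c m' \<Longrightarrow> pbounded c (\<lambda>x. m x + m' x)"
  unfolding pbounded_def
proof (elim exE)
  fix q q' assume "\<forall>x. m x \<le> poly q (tsize (c x))" "\<forall>x. m' x \<le> poly q' (tsize (c x))"
  then show "\<exists>q. \<forall>x. m x + m' x \<le> poly q (tsize (c x))"
    by (intro exI [of _ "q + q'"]) (simp add: add_mono)
qed

lemma pbounded_mult: "pbounded c m \<Longrightarrow> pbounded c m' \<Longrightarrow> pbounded c (\<lambda>x. m x * m' x)"
  unfolding pbounded_def
proof (elim exE)
  fix q q' assume "\<forall>x. m x \<le> poly q (tsize (c x))" "\<forall>x. m' x \<le> poly q' (tsize (c x))"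
  then show "\<exists>q. \<forall>x. m x * m' x \<le> poly q (tsize (c x))"
    by (intro exI [of _ "q * q'"]) (simp add: mult_mono)
qed

lemma pbounded_poly: "pbounded c m \<Longrightarrow> pbounded c (\<lambda>x. poly q (m x))"
  by (induction q) (auto intro: pbounded_const pbounded_add pbounded_mult)

lemma ptimeI:
  assumes "pbounded c m" and "\<And>x. \<exists>t. run p (c x) (e (f x)) t \<and> t \<le> m x"
  shows "ptime c e f"
  using assms unfolding ptime_def pbounded_def by (meson le_trans)

lemma ptimeE:
  assumes "ptime c e f"
  obtains p q where "\<And>x. \<exists>t. run p (c x) (e (f x)) t \<and> t \<le> poly q (tsize (c x))"
  using assms unfolding ptime_def by blast

text \<open>A run of cost \<open>t\<close> produces no tree larger than \<open>t\<close>. This keeps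
  intermediate results polynomially small under composition.\<close>

lemma pbounded_ptime: "ptime c e f \<Longrightarrow> pbounded c (\<lambda>x. tsize (e (f x)))"
  unfolding ptime_def pbounded_def by (meson le_trans run_size_le)

lemmas pbounded_intros =
  pbounded_const pbounded_size pbounded_add pbounded_mult pbounded_poly

text \<open>Programs see only encodings, so a function may be exchanged for one with the same
  encoded values, even of another type: a length, for instance, for a list of units.\<close>

lemma ptime_cong_encoding:
  "ptime c e f \<Longrightarrow> (\<And>x. e' (g x) = e (f x)) \<Longrightarrow> ptime c e' g"
  unfolding ptime_def by simp

lemma run_leI: "run p x y t \<Longrightarrow> t \<le> m \<Longrightarrow> \<exists>t. run p x y t \<and> t \<le> m"
  by blast

section \<open>Closure under composition, constructors and branching\<close>

lemma ptime_id: "ptime c c (\<lambda>x. x)"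
  by (rule ptimeI [where p = Skip, OF pbounded_size]) (blast intro: run.Skip)

lemma ptime_comp:
  assumes "ptime d e g" "ptime c d f"
  shows "ptime c e (\<lambda>x. g (f x))"
proof -
  obtain p q where p: "\<And>y. \<exists>t. run p (d y) (e (g y)) t \<and> t \<le> poly q (tsize (d y))"
    using assms(1) by (rule ptimeE) (rule that)
  obtain p' q' where p': "\<And>x. \<exists>t. run p' (c x) (d (f x)) t \<and> t \<le> poly q' (tsize (c x))"
    using assms(2) by (rule ptimeE) (rule that)
  show ?thesis
  proof (rule ptimeI)
    show "pbounded c (\<lambda>x. poly q' (tsize (c x)) + poly q (tsize (d (f x))) + 1)"
      by (intro pbounded_intros pbounded_ptime assms)
    fix x
    show "\<exists>t. run (Seq p' p) (c x) (e (g (f x))) t \<and>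
        t \<le> poly q' (tsize (c x)) + poly q (tsize (d (f x))) + 1"
      using p [of "f x"] p' [of x] by (meson run.Seq add_mono le_refl)
  qed
qed

lemma ptime_Leaf: "ptime c e f \<Longrightarrow> (\<And>x. e' (g x) = Leaf) \<Longrightarrow> ptime c e' g"
  by (rule ptimeI [where p = MkLeaf, OF pbounded_size]) (auto intro: run.MkLeaf)

lemma ptime_Node:
  assumes "ptime c e1 f1" "ptime c e2 f2" "\<And>x. e (f x) = Node (e1 (f1 x)) (e2 (f2 x))"
  shows "ptime c e f"
proof -
  obtain p q where p: "\<And>x. \<exists>t. run p (c x) (e1 (f1 x)) t \<and> t \<le> poly q (tsize (c x))"
    using assms(1) by (rule ptimeE) (rule that)
  obtain p' q' where p': "\<And>x. \<exists>t. run p' (c x) (e2 (f2 x)) t \<and> t \<le> poly q' (tsize (c x))"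
    using assms(2) by (rule ptimeE) (rule that)
  show ?thesis
  proof (rule ptimeI)
    show "pbounded c (\<lambda>x. poly q (tsize (c x)) + poly q' (tsize (c x)) + tsize (c x)
        + (tsize (e1 (f1 x)) + tsize (e2 (f2 x)) + 1))"
      by (intro pbounded_intros pbounded_ptime assms(1,2))
    fix x
    obtain t t' where t: "run p (c x) (e1 (f1 x)) t" "t \<le> poly q (tsize (c x))"
      "run p' (c x) (e2 (f2 x)) t'" "t' \<le> poly q' (tsize (c x))"
      using p p' by blast
    show "\<exists>t. run (MkNode p p') (c x) (e (f x)) t \<and> t \<le> poly q (tsize (c x))
        + poly q' (tsize (c x)) + tsize (c x) + (tsize (e1 (f1 x)) + tsize (e2 (f2 x)) + 1)"
      unfolding assms(3) by (rule run_leI [OF run.MkNode [OF t(1,3)]]) (use t(2,4) in simp)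
  qed
qed

lemma ptime_left:
  assumes "ptime c e f" "\<And>x. e' (g x) = left (e (f x))"
  shows "ptime c e' g"
proof (rule ptime_cong_encoding)
  have "ptime (\<lambda>x. x) (\<lambda>x. x) left"
    by (rule ptimeI [where p = Left, OF pbounded_size]) (blast intro: run.Left)
  moreover have "ptime c (\<lambda>x. x) (\<lambda>x. e (f x))"
    using assms(1) unfolding ptime_def .
  ultimately show "ptime c (\<lambda>x. x) (\<lambda>x. left (e (f x)))" by (rule ptime_comp)
qed (rule assms(2))

lemma ptime_right:
  assumes "ptime c e f" "\<And>x. e' (g x) = right (e (f x))"
  shows "ptime c e' g"
proof (rule ptime_cong_encoding)
  have "ptime (\<lambda>x. x) (\<lambda>x. x) right"
    by (rule ptimeI [where p = Right, OF pbounded_size]) (blast intro: run.Right)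
  moreover have "ptime c (\<lambda>x. x) (\<lambda>x. e (f x))"
    using assms(1) unfolding ptime_def .
  ultimately show "ptime c (\<lambda>x. x) (\<lambda>x. right (e (f x)))" by (rule ptime_comp)
qed (rule assms(2))

lemma ptime_cond:
  assumes "ptime c d b" "ptime c e f" "ptime c e g"
  shows "ptime c e (\<lambda>x. if d (b x) \<noteq> Leaf then f x else g x)"
proof -
  obtain p q where p: "\<And>x. \<exists>t. run p (c x) (d (b x)) t \<and> t \<le> poly q (tsize (c x))"
    using assms(1) by (rule ptimeE) (rule that)
  obtain p1 q1 where p1: "\<And>x. \<exists>t. run p1 (c x) (e (f x)) t \<and> t \<le> poly q1 (tsize (c x))"
    using assms(2) by (rule ptimeE) (rule that)
  obtain p2 q2 where p2: "\<And>x. \<exists>t. run p2 (c x) (e (g x)) t \<and> t \<le> poly q2 (tsize (c x))"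
    using assms(3) by (rule ptimeE) (rule that)
  show ?thesis
  proof (rule ptimeI)
    show "pbounded c (\<lambda>x. poly q (tsize (c x)) + (poly q1 (tsize (c x)) + poly q2 (tsize (c x)))
        + tsize (c x))"
      by (intro pbounded_intros)
    fix x
    obtain t t1 t2 where t: "run p (c x) (d (b x)) t" "t \<le> poly q (tsize (c x))"
      "run p1 (c x) (e (f x)) t1" "t1 \<le> poly q1 (tsize (c x))"
      "run p2 (c x) (e (g x)) t2" "t2 \<le> poly q2 (tsize (c x))"
      using p p1 p2 by meson
    show "\<exists>t. run (Cond p p1 p2) (c x) (e (if d (b x) \<noteq> Leaf then f x else g x)) t \<and>
      t \<le> poly q (tsize (c x)) + (poly q1 (tsize (c x)) + poly q2 (tsize (c x))) + tsize (c x)"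
    proof (cases "d (b x) = Leaf")
      case True
      then show ?thesis using run_leI [OF run.CondFalse [OF t(1) [unfolded True] t(5)]] t(2,4,6)
        by simp
    next
      case False
      then show ?thesis using run_leI [OF run.CondTrue [OF t(1) False t(3)]] t(2,4,6)
        by simp
    qed
  qed
qed

text \<open>By induction on the encoded tree, so every value of every encoded type is available as a
  constant.\<close>

lemma ptime_const: "ptime c e (\<lambda>x. k)"
proof -
  have "ptime c (\<lambda>x. x) (\<lambda>x. s)" for s
  proof (induction s)
    case Leaf
    show ?case by (rule ptime_Leaf [OF ptime_id]) simp
  next
    case (Node s1 s2)
    then show ?case by (rule ptime_Node) simp
  qed
  then show ?thesis by (rule ptime_cong_encoding) simp
qed

section \<open>Pairs, Booleans and case analysis on lists\<close>

definition enc_prod :: "('a \<Rightarrow> tree) \<Rightarrow> ('b \<Rightarrow> tree) \<Rightarrow> 'a \<times> 'b \<Rightarrow> tree" where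
  "enc_prod a b p = Node (a (fst p)) (b (snd p))"

lemma ptime_fst: "ptime c (enc_prod a b) f \<Longrightarrow> ptime c a (\<lambda>x. fst (f x))"
  by (erule ptime_left) (simp add: enc_prod_def)

lemma ptime_snd: "ptime c (enc_prod a b) f \<Longrightarrow> ptime c b (\<lambda>x. snd (f x))"
  by (erule ptime_right) (simp add: enc_prod_def)

lemma ptime_Pair: "ptime c a f \<Longrightarrow> ptime c b g \<Longrightarrow> ptime c (enc_prod a b) (\<lambda>x. (f x, g x))"
  by (erule (1) ptime_Node) (simp add: enc_prod_def)

text \<open>Replaces composite arguments by projections of one pair. It then suffices to treat
  \<open>g\<close> on variables, where the closure rules apply by syntactic form.\<close>

lemma ptime_comp2:
  assumes "ptime (enc_prod a b) e (\<lambda>p. g (fst p) (snd p))" "ptime c a f1" "ptime c b f2"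
  shows "ptime c e (\<lambda>x. g (f1 x) (f2 x))"
  using ptime_comp [OF assms(1) ptime_Pair [OF assms(2,3)]] by simp

lemma ptime_comp3:
  assumes "ptime (enc_prod a (enc_prod b d)) e (\<lambda>p. g (fst p) (fst (snd p)) (snd (snd p)))"
    "ptime c a f1" "ptime c b f2" "ptime c d f3"
  shows "ptime c e (\<lambda>x. g (f1 x) (f2 x) (f3 x))"
  using ptime_comp [OF assms(1) ptime_Pair [OF assms(2) ptime_Pair [OF assms(3,4)]]] by simp

lemma ptime_if:
  assumes "ptime c enc_bool b" "ptime c e f" "ptime c e g"
  shows "ptime c e (\<lambda>x. if b x then f x else g x)"
proof -
  have "(enc_bool (b x) \<noteq> Leaf) = b x" for x by (simp add: enc_bool_def)
  then show ?thesis using ptime_cond [OF assms] by simp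
qed

lemma ptime_conj:
  assumes "ptime c enc_bool f" "ptime c enc_bool g"
  shows "ptime c enc_bool (\<lambda>x. f x \<and> g x)"
  by (rule ptime_cong_encoding [OF ptime_if [OF assms ptime_const [of _ _ False]]]) auto

lemma ptime_disj:
  assumes "ptime c enc_bool f" "ptime c enc_bool g"
  shows "ptime c enc_bool (\<lambda>x. f x \<or> g x)"
  by (rule ptime_cong_encoding [OF ptime_if [OF assms(1) ptime_const [of _ _ True] assms(2)]]) auto

lemma ptime_not:
  assumes "ptime c enc_bool f"
  shows "ptime c enc_bool (\<lambda>x. \<not> f x)"
  by (rule ptime_cong_encoding
      [OF ptime_if [OF assms ptime_const [of _ enc_bool False] ptime_const [of _ _ True]]]) auto

lemma ptime_Cons:
  "ptime c e f \<Longrightarrow> ptime c (enc_list e) g \<Longrightarrow> ptime c (enc_list e) (\<lambda>x. f x # g x)"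
  by (erule (1) ptime_Node) simp

lemma ptime_tl: "ptime c (enc_list e) f \<Longrightarrow> ptime c (enc_list e) (\<lambda>x. tl (f x))"
proof (erule ptime_right)
  show "enc_list e (tl (f x)) = right (enc_list e (f x))" for x by (cases "f x") auto
qed

text \<open>A cons cell and a pair have the same encoding. Pairing the input with the value of the
  list thus already yields context, head and tail for the second branch.\<close>

lemma ptime_case_list:
  assumes "ptime c (enc_list e) l" "ptime c d f"
    and "ptime (enc_prod c (enc_prod e (enc_list e))) d (\<lambda>z. g (fst z) (fst (snd z)) (snd (snd z)))"
  shows "ptime c d (\<lambda>x. case l x of [] \<Rightarrow> f x | h # t \<Rightarrow> g x h t)"
proof -
  obtain p q where p: "\<And>x. \<exists>t. run p (c x) (enc_list e (l x)) t \<and> t \<le> poly q (tsize (c x))"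
    using assms(1) by (rule ptimeE) (rule that)
  obtain p1 q1 where p1: "\<And>x. \<exists>t. run p1 (c x) (d (f x)) t \<and> t \<le> poly q1 (tsize (c x))"
    using assms(2) by (rule ptimeE) (rule that)
  obtain p2 q2 where p2: "\<And>z. \<exists>t. run p2 (enc_prod c (enc_prod e (enc_list e)) z)
      (d (g (fst z) (fst (snd z)) (snd (snd z)))) t \<and>
      t \<le> poly q2 (tsize (enc_prod c (enc_prod e (enc_list e)) z))"
    using assms(3) by (rule ptimeE) (rule that)
  have b: "pbounded c (\<lambda>x. tsize (enc_list e (l x)))"
    by (intro pbounded_ptime assms)
  let ?w = "\<lambda>x. tsize (c x) + tsize (enc_list e (l x)) + 1"
  let ?B = "\<lambda>x. poly q (tsize (c x)) + tsize (c x) + poly q1 (tsize (c x))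
      + (poly q (tsize (c x)) + tsize (c x) + tsize (c x) + ?w x + poly q2 (?w x) + 1)"
  show ?thesis
  proof (rule ptimeI)
    show "pbounded c ?B" by (intro pbounded_intros b)
    fix x
    obtain t where t: "run p (c x) (enc_list e (l x)) t" "t \<le> poly q (tsize (c x))"
      using p by blast
    show "\<exists>t. run (Cond p (Seq (MkNode Skip p) p2) p1) (c x)
        (d (case l x of [] \<Rightarrow> f x | h # t \<Rightarrow> g x h t)) t \<and> t \<le> ?B x"
    proof (cases "l x")
      case Nil
      obtain t1 where t1: "run p1 (c x) (d (f x)) t1" "t1 \<le> poly q1 (tsize (c x))"
        using p1 by blast
      from t(1) Nil have "run p (c x) Leaf t" by simp
      from run_leI [OF run.CondFalse [OF this t1(1)]] t(2) t1(2) Nil show ?thesis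
        by simp
    next
      case (Cons h r)
      obtain t2 where t2: "run p2 (Node (c x) (enc_list e (l x))) (d (g x h r)) t2"
        "t2 \<le> poly q2 (?w x)"
        using p2 [of "(x, h, r)"] Cons by (auto simp: enc_prod_def)
      have "enc_list e (l x) \<noteq> Leaf" using Cons by simp
      from run.CondTrue [OF t(1) this run.Seq [OF run.MkNode [OF run.Skip t(1)] t2(1)]]
      show ?thesis unfolding Cons list.case
        by (rule run_leI) (use t(2) t2(2) Cons in simp)
    qed
  qed
qed

lemma ptime_null:
  assumes "ptime c (enc_list e) f"
  shows "ptime c enc_bool (\<lambda>x. f x = [])"
  by (rule ptime_cong_encoding [OF ptime_case_list
      [OF assms ptime_const [of _ enc_bool True] ptime_const [of _ _ False]]])
    (auto split: list.splits)

lemma tsize_pos: "1 \<le> tsize x"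
  by (cases x) auto

section \<open>Loops over lists\<close>

lemma run_projections:
  shows run_RL: "run (Seq Right Left) x (left (right x)) (tsize x + tsize (right x) + 1)"
    and run_RR: "run (Seq Right Right) x (right (right x)) (tsize x + tsize (right x) + 1)"
    and run_RLL: "run (Seq Right (Seq Left Left)) x (left (left (right x)))
      (tsize x + (tsize (right x) + tsize (left (right x)) + 1) + 1)"
    and run_RLR: "run (Seq Right (Seq Left Right)) x (right (left (right x)))
      (tsize x + (tsize (right x) + tsize (left (right x)) + 1) + 1)"
  by (rule run.Seq [OF run.Right run.Left] run.Seq [OF run.Right run.Right]
      run.Seq [OF run.Right run.Seq [OF run.Left run.Left]]
      run.Seq [OF run.Right run.Seq [OF run.Left run.Right]])+

text \<open>The only use of \<open>While\<close>. The bound \<open>B\<close> on all partial results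
  excludes exponential growth: a polynomial-time step may double the size of its argument, so
  iterating it could otherwise blow up the state.\<close>

lemma ptime_fold:
  assumes step: "ptime (enc_prod c (enc_prod e d)) d (\<lambda>z. g (fst z) (fst (snd z)) (snd (snd z)))"
    and list: "ptime c (enc_list e) l" and init: "ptime c d i"
    and B: "pbounded c B"
    and le: "\<And>x n. tsize (d (fold (g x) (take n (l x)) (i x))) \<le> B x"
  shows "ptime c d (\<lambda>x. fold (g x) (l x) (i x))"
proof -
  obtain p q where p: "\<And>z. \<exists>t. run p (enc_prod c (enc_prod e d) z)
      (d (g (fst z) (fst (snd z)) (snd (snd z)))) t \<and>
      t \<le> poly q (tsize (enc_prod c (enc_prod e d) z))"
    using step by (rule ptimeE) (rule that)
  \<comment> \<open>The loop state is \<open>Node context (Node rest acc)\<close>. The guard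
    \<open>G\<close> extracts the rest, which is \<open>Leaf\<close> exactly for the empty list;
    \<open>arg\<close> assembles context, head and accumulator as input of \<open>p\<close>;
    \<open>body\<close> installs the tail and the new accumulator.\<close>
  define G where "G = Seq Right Left"
  define arg where "arg = MkNode Left (MkNode (Seq Right (Seq Left Left)) (Seq Right Right))"
  define body where "body = MkNode Left (MkNode (Seq Right (Seq Left Right)) (Seq arg p))"
  \<comment> \<open>\<open>S\<close> bounds every loop state, with 2 for its two outer nodes. A
    round costs \<open>poly q (S x)\<close> plus at most 24 times \<open>S x\<close> for the body
    and 3 times \<open>S x\<close> for the guard and the charge of the loop, so 30 leaves some
    slack.\<close>
  define S where "S x = tsize (c x) + tsize (enc_list e (l x)) + B x + 2" for x
  define K where "K x = poly q (S x) + 30 * S x" for x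
  have iter: "\<exists>t. run (While G body) (Node (c x) (Node (enc_list e r) (d s)))
      (Node (c x) (Node Leaf (d (fold (g x) r s)))) t \<and> t \<le> (length r + 1) * K x"
    if "\<And>n. tsize (d (fold (g x) (take n r) s)) \<le> B x"
      "tsize (enc_list e r) \<le> tsize (enc_list e (l x))" for x r s
    using that
  proof (induction r arbitrary: s)
    case Nil
    have "tsize (d s) \<le> B x" using Nil(1) [of 0] by simp
    have "run G (Node (c x) (Node Leaf (d s))) Leaf
        (tsize (Node (c x) (Node Leaf (d s))) + tsize (Node Leaf (d s)) + 1)"
      unfolding G_def using run_RL [of "Node (c x) (Node Leaf (d s))"] by simp
    from run_leI [OF run.WhileFalse [OF this]] show ?case using \<open>tsize (d s) \<le> B x\<close> tsize_pos [of "enc_list e (l x)"]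
      by (simp add: K_def S_def)
  next
    case (Cons h r)
    define y where "y = g x h s"
    let ?X = "c x" and ?L = "Node (e h) (enc_list e r)"
    let ?z = "Node ?X (Node ?L (d s))"
    have s: "tsize (d s) \<le> B x" using Cons.prems(1) [of 0] by simp
    have y: "tsize (d y) \<le> B x" using Cons.prems(1) [of 1] by (simp add: y_def)
    have L: "tsize ?L \<le> tsize (enc_list e (l x))" using Cons.prems(2) by simp
    have z: "tsize ?z \<le> S x" using s L by (simp add: S_def)
    have G: "run G ?z ?L (tsize ?z + tsize (Node ?L (d s)) + 1)"
      unfolding G_def using run_RL [of ?z] by simp
    obtain ta where ta: "run arg ?z (Node ?X (Node (e h) (d s))) ta" "ta \<le> 14 * S x"
    proof -
      have RR: "run (Seq Right Right) ?z (d s) (tsize ?z + tsize (Node ?L (d s)) + 1)"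
        using run_RR [of ?z] by simp
      have "run (Seq Right (Seq Left Left)) ?z (e h)
          (tsize ?z + (tsize (Node ?L (d s)) + tsize ?L + 1) + 1)"
        using run_RLL [of ?z] by simp
      from run.MkNode [OF run.Left [of ?z] run.MkNode [OF this RR]]
      have "run arg ?z (Node ?X (Node (e h) (d s)))
        (tsize ?z +
          ((tsize ?z + (tsize (Node ?L (d s)) + tsize ?L + 1) + 1) +
           (tsize ?z + tsize (Node ?L (d s)) + 1) + tsize ?z + tsize (Node (e h) (d s)))
          + tsize ?z + tsize (Node ?X (Node (e h) (d s))))"
        unfolding arg_def by (simp only: left.simps)
      then show thesis by (rule that) (use z in simp)
    qed
    obtain tp where tp: "run p (Node ?X (Node (e h) (d s))) (d y) tp" "tp \<le> poly q (S x)"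
    proof -
      obtain tp where "run p (Node ?X (Node (e h) (d s))) (d y) tp"
        "tp \<le> poly q (tsize (Node ?X (Node (e h) (d s))))"
        using p [of "(x, h, s)"] by (auto simp: enc_prod_def y_def)
      moreover have "tsize (Node ?X (Node (e h) (d s))) \<le> S x" using z by simp
      then have "poly q (tsize (Node ?X (Node (e h) (d s)))) \<le> poly q (S x)" by (rule poly_nat_mono)
      ultimately show thesis using that le_trans by blast
    qed
    let ?z' = "Node ?X (Node (enc_list e r) (d y))"
    have z': "tsize ?z' \<le> S x" using y L by (simp add: S_def)
    have "run (Seq Right (Seq Left Right)) ?z (enc_list e r)
        (tsize ?z + (tsize (Node ?L (d s)) + tsize ?L + 1) + 1)"
      using run_RLR [of ?z] by simp
    from run.MkNode [OF run.Left [of ?z] run.MkNode [OF this run.Seq [OF ta(1) tp(1)]]]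
    have body: "run body ?z ?z' (tsize ?z +
        ((tsize ?z + (tsize (Node ?L (d s)) + tsize ?L + 1) + 1) + (ta + tp + 1) + tsize ?z
          + tsize (Node (enc_list e r) (d y))) + tsize ?z + tsize ?z')"
      unfolding body_def by (simp only: left.simps)
    obtain tb where tb: "run body ?z ?z' tb" "tb \<le> poly q (S x) + 24 * S x"
      by (rule that [OF body]) (use ta(2) tp(2) z z' in simp)
    have "\<exists>t. run (While G body) ?z' (Node (c x) (Node Leaf (d (fold (g x) r y)))) t
        \<and> t \<le> (length r + 1) * K x"
    proof (rule Cons.IH)
      show "tsize (d (fold (g x) (take n r) y)) \<le> B x" for n
        using Cons.prems(1) [of "Suc n"] by (simp add: y_def)
    qed (use L in simp)
    then obtain t where t: "run (While G body) ?z' (Node (c x) (Node Leaf (d (fold (g x) r y)))) t"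
      "t \<le> (length r + 1) * K x" by blast
    have "tsize ?z + tsize (Node ?L (d s)) + 1 + tb + t + tsize ?z \<le> (length (h # r) + 1) * K x"
      using tb(2) t(2) z by (simp add: K_def)
    with run.WhileTrue [OF G _ tb(1) t(1)] show ?case
      unfolding fold.simps comp_apply enc_list.simps y_def [symmetric] by blast
  qed
  have len: "length xs \<le> tsize (enc_list e xs)" for xs by (induction xs) auto
  have "ptime c (enc_prod c (enc_prod (enc_list e) d)) (\<lambda>x. (x, l x, i x))"
    by (intro ptime_Pair ptime_id list init)
  then obtain p0 q0 where p0: "\<And>x. \<exists>t. run p0 (c x) (Node (c x) (Node (enc_list e (l x)) (d (i x)))) t
      \<and> t \<le> poly q0 (tsize (c x))"
    by (rule ptimeE) (rule that, simp add: enc_prod_def)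
  show ?thesis
  proof (rule ptimeI)
    have "pbounded c S" unfolding S_def
      by (intro pbounded_intros pbounded_ptime list B)
    then have "pbounded c K" unfolding K_def by (intro pbounded_intros)
    then show "pbounded c (\<lambda>x. poly q0 (tsize (c x)) +
        ((tsize (enc_list e (l x)) + 1) * K x + (2 * (tsize (c x) + B x + 5)) + 1) + 1)"
      by (intro pbounded_intros pbounded_ptime list B)
    fix x
    obtain t0 where t0: "run p0 (c x) (Node (c x) (Node (enc_list e (l x)) (d (i x)))) t0"
      "t0 \<le> poly q0 (tsize (c x))" using p0 by blast
    let ?y = "Node (c x) (Node Leaf (d (fold (g x) (l x) (i x))))"
    obtain t1 where t1: "run (While G body) (Node (c x) (Node (enc_list e (l x)) (d (i x)))) ?y t1"
      "t1 \<le> (length (l x) + 1) * K x"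
      using iter [of x "l x" "i x"] le by auto
    have "run (Seq Right Right) ?y (d (fold (g x) (l x) (i x))) (tsize ?y + tsize (right ?y) + 1)"
      using run_RR [of ?y] by simp
    from run.Seq [OF t0(1) run.Seq [OF t1(1) this]]
    have "run (Seq p0 (Seq (While G body) (Seq Right Right))) (c x) (d (fold (g x) (l x) (i x)))
        (t0 + (t1 + (tsize ?y + tsize (right ?y) + 1) + 1) + 1)" .
    moreover have fin: "tsize (d (fold (g x) (l x) (i x))) \<le> B x"
      using le [of x "length (l x)"] by simp
    have "(length (l x) + 1) * K x \<le> (tsize (enc_list e (l x)) + 1) * K x"
      using len [of "l x"] by (intro mult_right_mono) auto
    with t1(2) have "t1 \<le> (tsize (enc_list e (l x)) + 1) * K x" by (rule le_trans)
    then have "t0 + (t1 + (tsize ?y + tsize (right ?y) + 1) + 1) + 1 \<le> poly q0 (tsize (c x)) +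
        ((tsize (enc_list e (l x)) + 1) * K x + (tsize ?y + tsize (right ?y) + 1) + 1) + 1"
      using t0(2) by (intro add_mono le_refl)
    moreover have "tsize ?y + tsize (right ?y) + 1 \<le> 2 * (tsize (c x) + B x + 5)"
      using fin by simp
    ultimately show "\<exists>t. run (Seq p0 (Seq (While G body) (Seq Right Right))) (c x)
        (d (fold (g x) (l x) (i x))) t \<and> t \<le> poly q0 (tsize (c x)) +
        ((tsize (enc_list e (l x)) + 1) * K x + (2 * (tsize (c x) + B x + 5)) + 1) + 1"
      by (elim run_leI) (erule le_trans, intro add_mono le_refl)
  qed
qed

lemma tsize_enc_list: "tsize (enc_list e xs) = 1 + (\<Sum>x\<leftarrow>xs. 1 + tsize (e x))"
  by (induction xs) auto

lemma tsize_enc_list_append: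
  "tsize (enc_list e (xs @ ys)) + 1 = tsize (enc_list e xs) + tsize (enc_list e ys)"
  by (simp add: tsize_enc_list)

lemma tsize_enc_list_rev: "tsize (enc_list e (rev xs)) = tsize (enc_list e xs)"
  by (simp add: tsize_enc_list rev_map [symmetric] sum_list_rev)

lemma tsize_enc_list_take: "tsize (enc_list e (take n xs)) \<le> tsize (enc_list e xs)"
  using tsize_enc_list_append [of e "take n xs" "drop n xs"] tsize_pos [of "enc_list e (drop n xs)"]
  by simp

lemma tsize_enc_list_drop: "tsize (enc_list e (drop n xs)) \<le> tsize (enc_list e xs)"
  using tsize_enc_list_append [of e "take n xs" "drop n xs"] tsize_pos [of "enc_list e (take n xs)"]
  by simp

lemma tsize_enc_list_le:
  "(\<And>x. x \<in> set xs \<Longrightarrow> tsize (e x) \<le> b) \<Longrightarrow> tsize (enc_list e xs) \<le> 1 + length xs * (1 + b)"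
proof (induction xs)
  case (Cons x xs)
  have "tsize (e x) \<le> b" "tsize (enc_list e xs) \<le> 1 + length xs * (1 + b)"
    using Cons by simp_all
  then show ?case by simp
qed simp

lemma length_le_tsize: "length xs \<le> tsize (enc_list e xs)"
  by (induction xs) auto

lemma tsize_enc_list_member: "x \<in> set xs \<Longrightarrow> tsize (e x) \<le> tsize (enc_list e xs)"
  by (induction xs) auto

lemma ptime_fold_invariant:
  assumes "ptime (enc_prod c (enc_prod e d)) d (\<lambda>z. g (fst z) (fst (snd z)) (snd (snd z)))"
    and "ptime c (enc_list e) l" and "ptime c d i" and "pbounded c B"
    and init: "\<And>x. I x (i x)"
    and step: "\<And>x y s. y \<in> set (l x) \<Longrightarrow> I x s \<Longrightarrow> I x (g x y s)"
    and size: "\<And>x s. I x s \<Longrightarrow> tsize (d s) \<le> B x"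
  shows "ptime c d (\<lambda>x. fold (g x) (l x) (i x))"
proof (rule ptime_fold [OF assms(1-4)])
  fix x n
  have "I x (fold (g x) ys s)" if "I x s" "set ys \<subseteq> set (l x)" for ys s
    using that by (induction ys arbitrary: s) (auto intro: step)
  then show "tsize (d (fold (g x) (take n (l x)) (i x))) \<le> B x"
    by (intro size) (auto intro: init dest: in_set_takeD)
qed

section \<open>Operations on lists\<close>

lemma ptime_rev:
  assumes "ptime c (enc_list e) l"
  shows "ptime c (enc_list e) (\<lambda>x. rev (l x))"
proof -
  have "ptime c (enc_list e) (\<lambda>x. fold Cons (l x) [])"
  proof (rule ptime_fold [where g = "\<lambda>_. Cons"])
    show "tsize (enc_list e (fold Cons (take n (l x)) [])) \<le> tsize (enc_list e (l x))" for x n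
      by (simp add: fold_Cons_rev tsize_enc_list_rev tsize_enc_list_take)
  qed (rule assms ptime_Cons ptime_fst ptime_snd ptime_id ptime_const pbounded_ptime)+
  then show ?thesis by (simp add: fold_Cons_rev)
qed

lemma ptime_append:
  assumes "ptime c (enc_list e) l" "ptime c (enc_list e) k"
  shows "ptime c (enc_list e) (\<lambda>x. l x @ k x)"
proof -
  have "ptime c (enc_list e) (\<lambda>x. fold Cons (rev (l x)) (k x))"
  proof (rule ptime_fold [where g = "\<lambda>_. Cons"])
    show "tsize (enc_list e (fold Cons (take n (rev (l x))) (k x)))
        \<le> tsize (enc_list e (l x)) + tsize (enc_list e (k x))" for x n
      using tsize_enc_list_append [of e "rev (take n (rev (l x)))" "k x"]
        tsize_enc_list_take [of e n "rev (l x)"]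
      by (simp add: fold_Cons_rev tsize_enc_list_rev)
  qed (rule assms ptime_Cons ptime_fst ptime_snd ptime_id ptime_rev pbounded_add pbounded_ptime)+
  then show ?thesis by (simp add: fold_Cons_rev)
qed

lemma ptime_concat:
  assumes "ptime c (enc_list (enc_list e)) l"
  shows "ptime c (enc_list e) (\<lambda>x. concat (l x))"
proof -
  have fold: "fold append ls ys = concat (rev ls) @ ys" for ls and ys :: "'b list"
    by (induction ls arbitrary: ys) auto
  have size: "tsize (enc_list e (concat ls)) \<le> tsize (enc_list (enc_list e) ls)" for ls
  proof (induction ls)
    case (Cons a ls)
    then show ?case using tsize_enc_list_append [of e a "concat ls"] by simp
  qed simp
  have "ptime c (enc_list e) (\<lambda>x. fold append (rev (l x)) [])"
  proof (rule ptime_fold [where g = "\<lambda>_. append"])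
    show "tsize (enc_list e (fold append (take n (rev (l x))) []))
        \<le> tsize (enc_list (enc_list e) (l x))" for x n
      using size [of "rev (take n (rev (l x)))"] tsize_enc_list_take [of "enc_list e" n "rev (l x)"]
      by (simp add: fold tsize_enc_list_rev)
  qed (rule assms ptime_append ptime_fst ptime_snd ptime_id ptime_rev ptime_const pbounded_ptime)+
  then show ?thesis by (simp add: fold)
qed

text \<open>One polynomial in the size of the whole list bounds each value, and that size also
  bounds the number of values. The fold builds the result backward, hence the final
  reversal.\<close>

lemma ptime_map:
  assumes "ptime (enc_prod c e) d (\<lambda>z. g (fst z) (snd z))" "ptime c (enc_list e) l"
  shows "ptime c (enc_list d) (\<lambda>x. map (g x) (l x))"
proof -
  have fold: "fold (\<lambda>y acc. g x y # acc) ys acc = rev (map (g x) ys) @ acc" for x ys acc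
    by (induction ys arbitrary: acc) auto
  obtain q where q: "\<And>z. tsize (d (g (fst z) (snd z))) \<le> poly q (tsize (enc_prod c e z))"
    using pbounded_ptime [OF assms(1)] unfolding pbounded_def by blast
  let ?b = "\<lambda>x. poly q (1 + tsize (c x) + tsize (enc_list e (l x)))"
  have "ptime c (enc_list d) (\<lambda>x. fold (\<lambda>y acc. g x y # acc) (l x) [])"
  proof (rule ptime_fold)
    show "ptime (enc_prod c (enc_prod e (enc_list d))) (enc_list d)
        (\<lambda>z. g (fst z) (fst (snd z)) # snd (snd z))"
      by (rule ptime_Cons ptime_comp2 [OF assms(1)] ptime_fst ptime_snd ptime_id)+
    show "pbounded c (\<lambda>x. 1 + tsize (enc_list e (l x)) * (1 + ?b x))"
      by (intro pbounded_intros pbounded_ptime assms)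
    fix x n
    have b: "tsize (d (g x y)) \<le> ?b x" if "y \<in> set (take n (l x))" for y
    proof -
      have "tsize (d (g x y)) \<le> poly q (1 + tsize (c x) + tsize (e y))"
        using q [of "(x, y)"] by (simp add: enc_prod_def)
      also have "\<dots> \<le> ?b x"
        using tsize_enc_list_member [OF in_set_takeD [OF that], of e] by (intro poly_nat_mono) simp
      finally show ?thesis .
    qed
    have "tsize (enc_list d (map (g x) (take n (l x))))
        \<le> 1 + length (map (g x) (take n (l x))) * (1 + ?b x)"
      by (rule tsize_enc_list_le) (use b in auto)
    also have "\<dots> \<le> 1 + tsize (enc_list e (l x)) * (1 + ?b x)"
      using length_le_tsize [of "l x" e] by (intro add_mono mult_right_mono) auto
    finally show "tsize (enc_list d (fold (\<lambda>y acc. g x y # acc) (take n (l x)) []))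
        \<le> 1 + tsize (enc_list e (l x)) * (1 + ?b x)"
      by (simp add: fold tsize_enc_list_rev)
  qed (rule assms ptime_const)+
  from ptime_rev [OF this] show ?thesis by (simp add: fold)
qed

lemma ptime_filter:
  assumes "ptime (enc_prod c e) enc_bool (\<lambda>z. P (fst z) (snd z))" "ptime c (enc_list e) l"
  shows "ptime c (enc_list e) (\<lambda>x. filter (P x) (l x))"
proof -
  have "ptime c (enc_list e) (\<lambda>x. concat (map (\<lambda>y. if P x y then [y] else []) (l x)))"
    by (rule ptime_concat ptime_map assms ptime_if ptime_Cons ptime_snd ptime_id ptime_const)+
  moreover have "concat (map (\<lambda>y. if P x y then [y] else []) ys) = filter (P x) ys" for x ys
    by (induction ys) auto
  ultimately show ?thesis by simp
qed

lemma ptime_bex: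
  assumes "ptime (enc_prod c e) enc_bool (\<lambda>z. P (fst z) (snd z))" "ptime c (enc_list e) l"
  shows "ptime c enc_bool (\<lambda>x. \<exists>y\<in>set (l x). P x y)"
proof -
  have "ptime c enc_bool (\<lambda>x. \<not> filter (P x) (l x) = [])"
    by (rule ptime_not ptime_null ptime_filter assms)+
  then show ?thesis by (simp add: filter_empty_conv)
qed

lemma ptime_product:
  assumes "ptime c (enc_list d) l" "ptime c (enc_list e) k"
  shows "ptime c (enc_list (enc_prod d e)) (\<lambda>x. List.product (l x) (k x))"
proof -
  have "ptime c (enc_list (enc_prod d e)) (\<lambda>x. concat (map (\<lambda>a. map (Pair a) (k x)) (l x)))"
    by (rule ptime_concat ptime_map ptime_Pair ptime_fst ptime_snd ptime_id assms
        ptime_comp [OF assms(2)])+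
  then show ?thesis by (simp add: product_concat_map)
qed

section \<open>Unary numbers and their arithmetic\<close>

definition enc_nat :: "nat \<Rightarrow> tree" where
  "enc_nat n = enc_list (\<lambda>_. Leaf) (replicate n ())"

lemma enc_nat_0: "enc_nat 0 = Leaf"
  by (simp add: enc_nat_def)

lemma enc_nat_Suc: "enc_nat (Suc n) = Node Leaf (enc_nat n)"
  by (simp add: enc_nat_def)

lemma tsize_enc_nat: "tsize (enc_nat n) = 2 * n + 1"
  by (induction n) (simp_all add: enc_nat_0 enc_nat_Suc)

text \<open>A unary number is a list of units and can serve as the counter of a fold. Vertices and
  credits do not exceed the number of rows, so unary notation is affordable for them; the budget
  stays binary because its value may be exponential in the input size.\<close>

lemma ptime_unary: "ptime c enc_nat n \<Longrightarrow> ptime c (enc_list (\<lambda>_. Leaf)) (\<lambda>x. replicate (n x) ())"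
  by (erule ptime_cong_encoding) (simp add: enc_nat_def)

lemma ptime_funpow:
  assumes "ptime (enc_prod c d) d (\<lambda>z. g (fst z) (snd z))" "ptime c enc_nat n" "ptime c d i"
    and "pbounded c B" "\<And>x m. m \<le> n x \<Longrightarrow> tsize (d ((g x ^^ m) (i x))) \<le> B x"
  shows "ptime c d (\<lambda>x. (g x ^^ n x) (i x))"
proof -
  have fold: "fold (\<lambda>_. g x) (replicate m ()) s = (g x ^^ m) s" for x m s
    by (induction m arbitrary: s) (simp_all add: funpow_swap1)
  have "ptime c d (\<lambda>x. fold (\<lambda>_. g x) (replicate (n x) ()) (i x))"
  proof (rule ptime_fold)
    show "tsize (d (fold (\<lambda>_. g x) (take m (replicate (n x) ())) (i x))) \<le> B x" for x m
      unfolding take_replicate fold by (rule assms(5)) simp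
  qed (rule assms(2-4) ptime_unary ptime_comp2 [OF assms(1)] ptime_fst ptime_snd ptime_id)+
  then show ?thesis by (simp add: fold)
qed

lemma ptime_Suc: "ptime c enc_nat f \<Longrightarrow> ptime c enc_nat (\<lambda>x. Suc (f x))"
  by (erule ptime_Node [OF ptime_const [of _ "\<lambda>_. Leaf" "()"]]) (simp add: enc_nat_Suc)

lemma ptime_pred: "ptime c enc_nat f \<Longrightarrow> ptime c enc_nat (\<lambda>x. f x - 1)"
proof (erule ptime_right)
  show "enc_nat (f x - 1) = right (enc_nat (f x))" for x
    by (cases "f x") (auto simp: enc_nat_0 enc_nat_Suc)
qed

lemma ptime_eq_0:
  assumes "ptime c enc_nat f"
  shows "ptime c enc_bool (\<lambda>x. f x = 0)"
  using ptime_null [OF ptime_unary [OF assms]] by simp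

lemma ptime_diff:
  assumes "ptime c enc_nat f" "ptime c enc_nat g"
  shows "ptime c enc_nat (\<lambda>x. f x - g x)"
proof -
  have funpow: "((\<lambda>i. i - 1) ^^ m) i = i - m" for m i :: nat
    by (induction m) auto
  have "ptime c enc_nat (\<lambda>x. ((\<lambda>i. i - 1) ^^ g x) (f x))"
  proof (rule ptime_funpow)
    show "tsize (enc_nat (((\<lambda>i. i - 1) ^^ m) (f x))) \<le> tsize (enc_nat (f x))" for m x
      unfolding funpow tsize_enc_nat by simp
  qed (rule assms ptime_pred ptime_snd ptime_id pbounded_ptime)+
  then show ?thesis by (simp only: funpow)
qed

lemma ptime_nat_less:
  assumes "ptime c enc_nat f" "ptime c enc_nat g"
  shows "ptime c enc_bool (\<lambda>x. f x < g x)"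
  using ptime_not [OF ptime_eq_0 [OF ptime_diff [OF assms(2,1)]]] by (simp add: not_le)

lemma ptime_nat_eq:
  assumes "ptime c enc_nat f" "ptime c enc_nat g"
  shows "ptime c enc_bool (\<lambda>x. f x = g x)"
  by (rule ptime_cong_encoding [OF ptime_conj
      [OF ptime_not [OF ptime_nat_less [OF assms]] ptime_not [OF ptime_nat_less [OF assms(2,1)]]]])
    (auto simp: enc_bool_inject)

lemma ptime_length:
  assumes "ptime c (enc_list e) l"
  shows "ptime c enc_nat (\<lambda>x. length (l x))"
  by (rule ptime_cong_encoding [OF ptime_map [where d = "\<lambda>_. Leaf" and g = "\<lambda>_ _. ()"]])
    (auto simp: enc_nat_def map_replicate_const intro: assms ptime_const)

lemma ptime_drop:
  assumes "ptime c enc_nat n" "ptime c (enc_list e) l"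
  shows "ptime c (enc_list e) (\<lambda>x. drop (n x) (l x))"
proof -
  have funpow: "(tl ^^ m) ys = drop m ys" for m and ys :: "'b list"
    by (induction m) (simp_all add: drop_Suc tl_drop)
  have "ptime c (enc_list e) (\<lambda>x. (tl ^^ n x) (l x))"
  proof (rule ptime_funpow)
    show "tsize (enc_list e ((tl ^^ m) (l x))) \<le> tsize (enc_list e (l x))" for m x
      by (simp only: funpow tsize_enc_list_drop)
  qed (rule assms ptime_tl ptime_snd ptime_id pbounded_ptime)+
  then show ?thesis by (simp only: funpow)
qed

text \<open>Counting with a parity flag: the quotient advances at every second step.\<close>

lemma ptime_half:
  assumes "ptime c enc_nat f"
  shows "ptime c enc_nat (\<lambda>x. f x div 2)"
proof -
  let ?step = "\<lambda>s :: bool \<times> nat. (\<not> fst s, if fst s then Suc (snd s) else snd s)"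
  have funpow: "(?step ^^ m) (False, 0) = (odd m, m div 2)" for m
    by (induction m) auto
  have "ptime c (enc_prod enc_bool enc_nat) (\<lambda>x. (?step ^^ f x) (False, 0))"
  proof (rule ptime_funpow)
    show "tsize (enc_prod enc_bool enc_nat ((?step ^^ m) (False, 0))) \<le> tsize (enc_nat (f x)) + 5"
      if "m \<le> f x" for m x
      unfolding funpow using that by (auto simp: enc_prod_def enc_bool_def tsize_enc_nat)
  qed (rule assms ptime_Pair ptime_not ptime_if ptime_Suc ptime_fst ptime_snd ptime_id ptime_const
      pbounded_add pbounded_const pbounded_ptime)+
  from ptime_snd [OF this] show ?thesis by (simp only: funpow snd_conv)
qed

lemma ptime_upt:
  assumes "ptime c enc_nat f"
  shows "ptime c (enc_list enc_nat) (\<lambda>x. [0..<f x])"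
proof -
  let ?step = "\<lambda>ys. ys @ [length ys]"
  have funpow: "(?step ^^ m) [] = [0..<m]" for m
    by (induction m) auto
  have "ptime c (enc_list enc_nat) (\<lambda>x. (?step ^^ f x) [])"
  proof (rule ptime_funpow)
    show "tsize (enc_list enc_nat ((?step ^^ m) []))
        \<le> 1 + tsize (enc_nat (f x)) * (1 + tsize (enc_nat (f x)))"
      if "m \<le> f x" for m x
    proof -
      have "tsize (enc_list enc_nat [0..<m]) \<le> 1 + length [0..<m] * (1 + tsize (enc_nat (f x)))"
        by (rule tsize_enc_list_le) (use that in \<open>auto simp: tsize_enc_nat\<close>)
      also have "\<dots> \<le> 1 + tsize (enc_nat (f x)) * (1 + tsize (enc_nat (f x)))"
        using that by (intro add_mono mult_right_mono) (auto simp: tsize_enc_nat)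
      finally show ?thesis by (simp only: funpow)
    qed
  qed (rule assms ptime_append ptime_Cons ptime_length ptime_snd ptime_id ptime_const
      pbounded_add pbounded_mult pbounded_const pbounded_ptime)+
  then show ?thesis by (simp only: funpow)
qed

text \<open>Folding over the digits of \<open>k\<close> halves \<open>m\<close>, rounding so that \<open>m \<le> k\<close> is preserved.\<close>

definition le_digits :: "nat \<Rightarrow> bool list \<Rightarrow> bool" where
  "le_digits m bs \<longleftrightarrow> fold (\<lambda>b m. if b then m div 2 else Suc m div 2) bs m = 0"

text \<open>An odd digit rounds down and an even one up: \<open>m \<le> 2 * j + 1\<close> iff
  \<open>m div 2 \<le> j\<close>, and \<open>m \<le> 2 * j\<close> iff
  \<open>Suc m div 2 \<le> j\<close>. After the last digit the comparison is with 0.\<close>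

lemma le_digits_binary: "le_digits m (binary k) \<longleftrightarrow> m \<le> k"
proof (induction k arbitrary: m rule: binary.induct)
  case (1 k)
  show ?case
  proof (cases "k = 0")
    case True
    then show ?thesis by (subst binary.simps) (simp add: le_digits_def)
  next
    case False
    then have "le_digits m (binary k) \<longleftrightarrow> le_digits (if odd k then m div 2 else Suc m div 2) (binary (k div 2))"
      by (subst binary.simps) (simp add: le_digits_def)
    also have "\<dots> \<longleftrightarrow> (if odd k then m div 2 else Suc m div 2) \<le> k div 2"
      using 1 False by simp
    also have "\<dots> \<longleftrightarrow> m \<le> k" by (auto elim!: oddE evenE)
    finally show ?thesis .
  qed
qed

lemma ptime_le_digits:
  assumes "ptime c enc_nat m" "ptime c (enc_list enc_bool) bs"
  shows "ptime c enc_bool (\<lambda>x. le_digits (m x) (bs x))"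
  unfolding le_digits_def
proof (rule ptime_eq_0, rule ptime_fold_invariant)
  show "tsize (enc_nat s) \<le> tsize (enc_nat (m x))" if "s \<le> m x" for x s
    using that by (simp add: tsize_enc_nat)
  show "(if b then s div 2 else Suc s div 2) \<le> m x" if "s \<le> m x" for b x s
    using that by auto
  show "m x \<le> m x" for x ..
qed (rule assms ptime_if ptime_half ptime_Suc ptime_fst ptime_snd ptime_id pbounded_ptime)+

section \<open>Triangles and feedback arc sets\<close>

definition triangle :: "('v \<times> 'v) set \<Rightarrow> 'v \<Rightarrow> 'v \<Rightarrow> 'v \<Rightarrow> bool" where
  "triangle A x y z \<longleftrightarrow> (x, y) \<in> A \<and> (y, z) \<in> A \<and> (z, x) \<in> A"

definition triangle_arcs :: "'v \<Rightarrow> 'v \<Rightarrow> 'v \<Rightarrow> ('v \<times> 'v) set" where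
  "triangle_arcs x y z = {(x, y), (y, z), (z, x)}"

lemma triangle_rotate: "triangle A x y z \<Longrightarrow> triangle A y z x"
  by (simp add: triangle_def)

lemma tournament_asym: "tournament V A \<Longrightarrow> (x, y) \<in> A \<Longrightarrow> (y, x) \<notin> A"
  unfolding tournament_def irrefl_def by (metis (no_types) SigmaE2 subsetD)

lemma tournament_total:
  "tournament V A \<Longrightarrow> x \<in> V \<Longrightarrow> y \<in> V \<Longrightarrow> x \<noteq> y \<Longrightarrow> (x, y) \<notin> A \<Longrightarrow> (y, x) \<in> A"
  unfolding tournament_def by blast

lemma tournament_arcD: "tournament V A \<Longrightarrow> (x, y) \<in> A \<Longrightarrow> x \<in> V \<and> y \<in> V"
  unfolding tournament_def by blast

lemma tournament_transitive:
  assumes "tournament V A" "(x, y) \<in> A" "(y, z) \<in> A" "\<not> triangle A x y z"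
  shows "(x, z) \<in> A"
proof (rule tournament_total [OF assms(1)])
  show "z \<in> V" "x \<in> V" using tournament_arcD [OF assms(1)] assms(2,3) by blast+
  show "z \<noteq> x" using tournament_asym [OF assms(1)] assms(2,3) by blast
  show "(z, x) \<notin> A" using assms(2-4) by (simp add: triangle_def)
qed

lemma acyclic_reverse_arcs_hits_triangle:
  assumes "acyclic (reverse_arcs F A)" "triangle A x y z"
  shows "triangle_arcs x y z \<inter> F \<noteq> {}"
proof
  assume "triangle_arcs x y z \<inter> F = {}"
  then have "(x, y) \<in> reverse_arcs F A" "(y, z) \<in> reverse_arcs F A" "(z, x) \<in> reverse_arcs F A"
    using assms(2) by (auto simp: triangle_def triangle_arcs_def reverse_arcs_def)
  then have "(x, x) \<in> (reverse_arcs F A)\<^sup>+"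
    by (meson trancl.intros)
  then show False using assms(1) by (simp add: acyclic_def)
qed

text \<open>Picking an element of \<open>T i\<close> in \<open>F\<close> is injective by
  disjointness. With triangles as \<open>T i\<close>, this is the source of all lower bounds on
  solutions.\<close>

lemma card_le_of_disjoint_hit:
  assumes "finite F" "\<And>i. i \<in> I \<Longrightarrow> T i \<inter> F \<noteq> {}"
    and "\<And>i j. i \<in> I \<Longrightarrow> j \<in> I \<Longrightarrow> T i \<inter> T j \<noteq> {} \<Longrightarrow> i = j"
  shows "card I \<le> card F"
proof -
  from assms(2) have "\<forall>i\<in>I. \<exists>h. h \<in> T i \<inter> F" by blast
  then obtain h where h: "\<And>i. i \<in> I \<Longrightarrow> h i \<in> T i \<inter> F" by metis
  show ?thesis
  proof (rule card_inj_on_le)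
    show "inj_on h I"
    proof (rule inj_onI)
      fix i j assume "i \<in> I" "j \<in> I" "h i = h j"
      with h [of i] h [of j] show "i = j" by (intro assms(3)) auto
    qed
  qed (use h assms(1) in auto)
qed

text \<open>Along an \<open>R\<close>-path \<open>\<phi>\<close> never decreases, so on a cycle it
  is constant, and the cycle would be one of \<open>S\<close>.\<close>

lemma acyclic_lexicographic:
  fixes \<phi> :: "'a \<Rightarrow> nat"
  assumes "\<And>x y. (x, y) \<in> R \<Longrightarrow> \<phi> x < \<phi> y \<or> \<phi> x = \<phi> y \<and> (x, y) \<in> S" "acyclic S"
  shows "acyclic R"
  unfolding acyclic_def
proof (intro allI notI)
  have "\<phi> x < \<phi> y \<or> \<phi> x = \<phi> y \<and> (x, y) \<in> S\<^sup>+" if "(x, y) \<in> R\<^sup>+" for x y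
    using that
  proof (induction rule: trancl_induct)
    case (base y)
    then show ?case using assms(1) by blast
  next
    case (step y z)
    then show ?case using assms(1) [of y z] by (auto intro: trancl_into_trancl)
  qed
  moreover fix x assume "(x, x) \<in> R\<^sup>+"
  ultimately show False using assms(2) unfolding acyclic_def by blast
qed

text \<open>The arcs mapped into a solution form a solution, since a remaining cycle would be mapped
  to a cycle. It is applied to the numbering of the kernel vertices and to the inverse
  numbering.\<close>

lemma fast_pullback:
  assumes "fast A k" "finite V" "B \<subseteq> V \<times> V" "inj_on h V"
    and iff: "\<And>x y. x \<in> V \<Longrightarrow> y \<in> V \<Longrightarrow> (x, y) \<in> B \<longleftrightarrow> (h x, h y) \<in> A"
  shows "fast B k"
proof -
  obtain F where F: "F \<subseteq> A" "finite F" "int (card F) \<le> k" "acyclic (reverse_arcs F A)"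
    using assms(1) unfolding fast_def by blast
  define G where "G = {(x, y) \<in> B. (h x, h y) \<in> F}"
  have "finite B" using assms(2,3) by (meson finite_SigmaI finite_subset)
  then have fin: "finite G" unfolding G_def by (rule rev_finite_subset) auto
  have "card G \<le> card F"
  proof (rule card_inj_on_le)
    show "inj_on (map_prod h h) G"
      by (rule inj_on_subset [OF map_prod_inj_on [OF assms(4,4)]]) (use assms(3) in \<open>auto simp: G_def\<close>)
  qed (use F in \<open>auto simp: G_def\<close>)
  moreover have "acyclic (reverse_arcs G B)"
    unfolding acyclic_def
  proof (intro allI notI)
    have arc: "(h y, h z) \<in> reverse_arcs F A" if "(y, z) \<in> reverse_arcs G B" for y z
      using that iff assms(3) by (fastforce simp: reverse_arcs_def G_def)
    have "(h x, h y) \<in> (reverse_arcs F A)\<^sup>+" if "(x, y) \<in> (reverse_arcs G B)\<^sup>+" for x y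
      using that
    proof (induction rule: trancl_induct)
      case (base y)
      then show ?case using arc by blast
    next
      case (step y z)
      then show ?case using arc by (meson trancl_into_trancl)
    qed
    moreover fix x assume "(x, x) \<in> (reverse_arcs G B)\<^sup>+"
    ultimately show False using F(4) unfolding acyclic_def by blast
  qed
  ultimately show ?thesis
    unfolding fast_def using F(3) fin by (intro exI [of _ G]) (auto simp: G_def)
qed

text \<open>
  Since \<open>W\<close> is transitive together with any further vertex, every vertex has a position \<open>\<phi>\<close>
  relative to \<open>W\<close>. The arcs going backward with respect to \<open>\<phi>\<close> are exactly those forming a triangle
  with some vertex of \<open>W\<close>. As they have arc-disjoint triangles inside \<open>X\<close>, they can be reversed at no
  loss, after which only arcs within a single position remain to be treated.
\<close>

lemma fast_of_fast_restrict:
  fixes A :: "('v \<times> 'v) set"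
  assumes T: "tournament V A" and WV: "W \<subseteq> V"
    and WW: "\<And>x y z. triangle A x y z \<Longrightarrow> x \<in> W \<Longrightarrow> y \<notin> W"
    and partner: "\<And>x y w. w \<in> W \<Longrightarrow> triangle A w x y \<Longrightarrow>
      f (x, y) \<in> W \<inter> X \<and> triangle A (f (x, y)) x y"
    and inj: "\<And>w x y w' x' y'. w \<in> W \<Longrightarrow> triangle A w x y \<Longrightarrow> w' \<in> W \<Longrightarrow> triangle A w' x' y' \<Longrightarrow>
      f (x, y) = f (x', y') \<Longrightarrow> (x, y) = (x', y')"
    and VX: "V - W \<subseteq> X"
    and fast: "fast (A \<inter> X \<times> X) k"
  shows "fast A k"
proof -
  have finV: "finite V" and AV: "A \<subseteq> V \<times> V" using T by (auto simp: tournament_def)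
  have finA: "finite A" using finV AV by (meson finite_SigmaI finite_subset)
  define before where "before v = {w \<in> W. (w, v) \<in> A}" for v
  \<comment> \<open>A vertex of \<open>W\<close> with \<open>i\<close> predecessors in
    \<open>W\<close> gets the odd position \<open>2 * i + 1\<close>, any other vertex with
    \<open>i\<close> such predecessors the even position \<open>2 * i\<close> of the gap behind
    them. Arcs touching \<open>W\<close> then go strictly upward.\<close>
  define \<phi> where "\<phi> v = 2 * card (before v) + of_bool (v \<in> W)" for v
  have fin: "finite (before v)" for v
    by (rule finite_subset [OF _ finite_subset [OF WV finV]]) (auto simp: before_def)
  have up1: "\<phi> x < \<phi> y" if "(x, y) \<in> A" "x \<in> W" for x y
  proof -
    \<comment> \<open>Otherwise some \<open>w\<close> in \<open>W\<close> would form a triangle with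
      \<open>x\<close> and \<open>y\<close>, having two vertices in \<open>W\<close>.\<close>
    have "insert x (before x) \<subseteq> before y"
    proof
      fix w assume "w \<in> insert x (before x)"
      then show "w \<in> before y"
        using that WW [of w x y] tournament_transitive [OF T, of w x y] by (auto simp: before_def)
    qed
    then have "card (insert x (before x)) \<le> card (before y)" by (rule card_mono [OF fin])
    moreover have "x \<notin> before x" using tournament_asym [OF T] by (auto simp: before_def)
    ultimately show ?thesis using fin by (simp add: \<phi>_def)
  qed
  have up2: "\<phi> x < \<phi> y" if "(x, y) \<in> A" "y \<in> W" for x y
  proof (cases "x \<in> W")
    case False
    have "before x \<subseteq> before y"
    proof
      fix w assume "w \<in> before x"
      then show "w \<in> before y"
        using that WW [OF triangle_rotate [OF triangle_rotate], of w x y]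
          tournament_transitive [OF T, of w x y] by (auto simp: before_def)
    qed
    then have "card (before x) \<le> card (before y)" by (rule card_mono [OF fin])
    then show ?thesis using False that by (simp add: \<phi>_def)
  qed (rule up1 [OF that(1)])
  define N where "N = {(x, y). \<exists>w\<in>W. triangle A w x y}"
  have NA: "N \<subseteq> A" by (auto simp: N_def triangle_def)
  have N_down: "\<phi> y < \<phi> x" if "(x, y) \<in> N" for x y
  proof -
    obtain w where w: "w \<in> W" "triangle A w x y" using \<open>(x, y) \<in> N\<close> by (auto simp: N_def)
    then have "\<phi> y < \<phi> w" "\<phi> w < \<phi> x"
      using up1 [of w x] up2 [of y w] by (simp_all add: triangle_def)
    then show ?thesis by simp
  qed
  have N_outside: "x \<notin> W" "y \<notin> W" if "(x, y) \<in> N" for x y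
  proof -
    obtain w where w: "w \<in> W" "triangle A w x y" using \<open>(x, y) \<in> N\<close> by (auto simp: N_def)
    show "x \<notin> W" using WW [OF w(2,1)] .
    show "y \<notin> W" using WW [OF triangle_rotate [OF triangle_rotate [OF w(2)]]] w(1) by blast
  qed
  \<comment> \<open>The higher position of \<open>x\<close> is due to some \<open>w\<close> in
    \<open>W\<close> that precedes \<open>x\<close> but not \<open>y\<close>; this \<open>w\<close>
    closes the triangle.\<close>
  have down_N: "(x, y) \<in> N" if "(x, y) \<in> A" "\<phi> y < \<phi> x" for x y
  proof -
    have "x \<notin> W" "y \<notin> W" using that up1 [of x y] up2 [of x y] by auto
    then have "card (before y) < card (before x)" using that by (simp add: \<phi>_def)
    then obtain w where "w \<in> before x" "w \<notin> before y"
      using card_mono [OF fin, of "before x" y] by (meson leD subsetI)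
    then have "w \<in> W" "(w, x) \<in> A" "(w, y) \<notin> A" "w \<noteq> y"
      using \<open>y \<notin> W\<close> by (auto simp: before_def)
    then have "(y, w) \<in> A" using that(1) tournament_total [OF T] tournament_arcD [OF T] by blast
    then show ?thesis using \<open>w \<in> W\<close> \<open>(w, x) \<in> A\<close> that(1) by (auto simp: N_def triangle_def)
  qed
  obtain F where F: "F \<subseteq> A \<inter> X \<times> X" "finite F" "int (card F) \<le> k"
    "acyclic (reverse_arcs F (A \<inter> X \<times> X))"
    using fast unfolding fast_def by blast
  \<comment> \<open>The part \<open>F0\<close> within positions is kept, while \<open>F1\<close> is
    exchanged for \<open>N\<close>, at no cost once \<open>card N \<le> card F1\<close>.\<close>
  define F0 where "F0 = {(x, y) \<in> F. \<phi> x = \<phi> y}"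
  define F1 where "F1 = {(x, y) \<in> F. \<phi> x \<noteq> \<phi> y}"
  have F01: "finite F0" "finite F1" "F = F0 \<union> F1" "F0 \<inter> F1 = {}"
    using F(2) by (auto simp: F0_def F1_def intro: rev_finite_subset)
  have "card N \<le> card F1"
  proof (rule card_le_of_disjoint_hit [where T = "\<lambda>e. triangle_arcs (f e) (fst e) (snd e)"])
    fix e assume "e \<in> N"
    obtain x y where e: "e = (x, y)" by (cases e)
    have xy: "(x, y) \<in> N" using \<open>e \<in> N\<close> e by simp
    then have f: "f e \<in> W" "f e \<in> X" "triangle A (f e) x y"
      using partner unfolding N_def e by blast+
    have "x \<in> X" "y \<in> X" using xy N_outside NA AV VX by blast+
    then have "triangle (A \<inter> X \<times> X) (f e) x y" using f by (simp add: triangle_def)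
    from acyclic_reverse_arcs_hits_triangle [OF F(4) this]
    obtain g where g: "g \<in> triangle_arcs (f e) x y" "g \<in> F" by blast
    \<comment> \<open>The vertices of this triangle have pairwise different positions, so its arc in
      \<open>F\<close> belongs to \<open>F1\<close>.\<close>
    moreover have "\<phi> (f e) < \<phi> x" "\<phi> y < \<phi> (f e)" "\<phi> y < \<phi> x"
      using f up1 up2 N_down [OF xy] by (auto simp: triangle_def)
    ultimately have "g \<in> F1" by (auto simp: F1_def triangle_arcs_def)
    with g(1) show "triangle_arcs (f e) (fst e) (snd e) \<inter> F1 \<noteq> {}" by (auto simp: e)
  next
    fix e e' assume "e \<in> N" "e' \<in> N"
      and *: "triangle_arcs (f e) (fst e) (snd e) \<inter> triangle_arcs (f e') (fst e') (snd e') \<noteq> {}"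
    obtain x y x' y' where e: "e = (x, y)" "e' = (x', y')" by (cases e, cases e')
    have "f e \<in> W" "f e' \<in> W" "x \<notin> W" "y \<notin> W" "x' \<notin> W" "y' \<notin> W"
      using partner N_outside \<open>e \<in> N\<close> \<open>e' \<in> N\<close> unfolding N_def e by blast+
    \<comment> \<open>Apart from \<open>e\<close>, the arcs of the triangle of \<open>e\<close>
      touch \<open>f e\<close>, its only vertex in \<open>W\<close>. A common arc of two such
      triangles forces equal apexes or equal base arcs.\<close>
    then have "f e = f e' \<or> e = e'" using * by (auto simp: triangle_arcs_def e)
    then show "e = e'" using inj \<open>e \<in> N\<close> \<open>e' \<in> N\<close> unfolding N_def e by blast
  qed (rule F01)
  moreover have "card (N \<union> F0) \<le> card N + card F0" by (rule card_Un_le)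
  moreover have "card F = card F0 + card F1" using F01 by (simp add: card_Un_disjoint)
  ultimately have card: "int (card (N \<union> F0)) \<le> k" using F(3) by linarith
  have "acyclic (reverse_arcs (N \<union> F0) A)"
  \<comment> \<open>Between different positions only upward arcs remain. Arcs within one position
    avoid \<open>W\<close>, so they lie inside \<open>X\<close> and are treated as in the given
    solution.\<close>
  proof (rule acyclic_lexicographic [OF _ F(4)])
    fix x y assume xy: "(x, y) \<in> reverse_arcs (N \<union> F0) A"
    show "\<phi> x < \<phi> y \<or> \<phi> x = \<phi> y \<and> (x, y) \<in> reverse_arcs F (A \<inter> X \<times> X)"
    proof (cases "(x, y) \<in> A - (N \<union> F0)")
      case True
      then have "\<phi> x \<le> \<phi> y" using down_N by (meson Diff_iff UnCI not_le)
      moreover have "(x, y) \<in> reverse_arcs F (A \<inter> X \<times> X)" if "\<phi> x = \<phi> y"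
      proof -
        have "x \<notin> W" "y \<notin> W" using True that up1 [of x y] up2 [of x y] by auto
        then have "x \<in> X" "y \<in> X" using True VX AV by blast+
        then show ?thesis using True that by (auto simp: reverse_arcs_def F0_def)
      qed
      ultimately show ?thesis by linarith
    next
      case False
      then have "(y, x) \<in> N \<or> (y, x) \<in> F0" using xy by (auto simp: reverse_arcs_def)
      then show ?thesis using N_down by (auto simp: F0_def reverse_arcs_def)
    qed
  qed
  moreover have "N \<union> F0 \<subseteq> A" using NA F(1) by (auto simp: F0_def)
  ultimately show ?thesis
    unfolding fast_def using card finA by (meson finite_subset)
qed

section \<open>Bipartite matching by auction\<close>

text \<open>
  Each bidder of \<open>U\<close> wants one of the items \<open>as\<close>. \<open>rem a\<close> is what remains of the initial credit \<open>n\<close>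
  of item \<open>a\<close> and decreases whenever \<open>a\<close> changes hands, \<open>own a\<close> is the list of its at most one owner,
  and \<open>fr\<close> lists the bidders still to be served. A bidder takes a suitable item of largest
  remaining credit and is dropped if there is none of positive credit.
\<close>

definition auction_invariant ::
    "('u \<Rightarrow> 'a \<Rightarrow> bool) \<Rightarrow> 'u set \<Rightarrow> nat \<Rightarrow> 'a list \<Rightarrow> 'u list \<Rightarrow> ('a \<Rightarrow> nat) \<Rightarrow> ('a \<Rightarrow> 'u list) \<Rightarrow> bool"
  where
  "auction_invariant R U n as fr rem own \<longleftrightarrow>
     distinct fr \<and> set fr \<subseteq> U \<and>
     (\<forall>a. length (own a) \<le> 1 \<and> rem a \<le> n) \<and>
     (\<forall>a u. u \<in> set (own a) \<longrightarrow> a \<in> set as \<and> u \<in> U \<and> R u a \<and> u \<notin> set fr) \<and>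
     (\<forall>a b u. u \<in> set (own a) \<longrightarrow> u \<in> set (own b) \<longrightarrow> a = b) \<and>
     (\<forall>a. own a = [] \<longrightarrow> rem a = n) \<and>
     (\<forall>u\<in>U. u \<notin> set fr \<longrightarrow> (\<forall>a. u \<notin> set (own a)) \<longrightarrow> (\<forall>a\<in>set as. R u a \<longrightarrow> rem a = 0)) \<and>
     (\<forall>a u. u \<in> set (own a) \<longrightarrow> (\<forall>b\<in>set as. R u b \<longrightarrow> rem b \<le> rem a + 1))"

lemma auction_invariant_drop:
  assumes "auction_invariant R U n as (u # fr) rem own"
    and "\<And>a. a \<in> set as \<Longrightarrow> R u a \<Longrightarrow> rem a = 0"
  shows "auction_invariant R U n as fr rem own"
  using assms unfolding auction_invariant_def by auto

text \<open>Only the credit of \<open>a\<close> changes, and it does not rise, so the conditions on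
  dropped bidders and on the owners of other items persist. For the new owner the last condition
  holds because it chose an item of largest credit, which then lost at most one unit.\<close>

lemma auction_invariant_assign:
  assumes inv: "auction_invariant R U n as (u # fr) rem own"
    and a: "a \<in> set as" "R u a" "\<And>b. b \<in> set as \<Longrightarrow> R u b \<Longrightarrow> rem b \<le> rem a"
  shows "auction_invariant R U n as (own a @ fr) (rem(a := rem a - 1)) (own(a := [u]))"
proof -
  have own: "own a = [] \<or> (\<exists>v. own a = [v])"
    using inv unfolding auction_invariant_def by (metis One_nat_def le_Suc_eq le_zero_eq length_0_conv length_Suc_conv)
  have free: "u \<notin> set (own b)" "set fr \<inter> set (own b) = {}" for b
    using inv unfolding auction_invariant_def by auto
  have uniq: "\<And>b c v. v \<in> set (own b) \<Longrightarrow> v \<in> set (own c) \<Longrightarrow> b = c"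
    and cand: "\<And>b v. v \<in> set (own b) \<Longrightarrow> b \<in> set as \<and> v \<in> U \<and> R v b"
    and dist: "distinct (u # fr)" "set (u # fr) \<subseteq> U"
    and bnd: "\<And>b. length (own b) \<le> 1 \<and> rem b \<le> n"
    and unowned: "\<And>b. own b = [] \<Longrightarrow> rem b = n"
    and dropped: "\<And>v b. v \<in> U \<Longrightarrow> v \<notin> set (u # fr) \<Longrightarrow> (\<And>b. v \<notin> set (own b)) \<Longrightarrow>
        b \<in> set as \<Longrightarrow> R v b \<Longrightarrow> rem b = 0"
    and slack: "\<And>b c v. v \<in> set (own b) \<Longrightarrow> c \<in> set as \<Longrightarrow> R v c \<Longrightarrow> rem c \<le> rem b + 1"
    using inv unfolding auction_invariant_def by blast+
  let ?rem = "rem(a := rem a - 1)" and ?own = "own(a := [u])"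
  have 1: "distinct (own a @ fr)" "set (own a @ fr) \<subseteq> U"
    using own dist free [of a] cand [of _ a] by auto
  have 2: "length (?own b) \<le> 1 \<and> ?rem b \<le> n" for b
    using bnd [of b] bnd [of a] by auto
  have 3: "b \<in> set as \<and> v \<in> U \<and> R v b \<and> v \<notin> set (own a @ fr)" if "v \<in> set (?own b)" for b v
    using that a(1,2) free dist cand uniq by (auto split: if_splits)
  have 4: "b = c" if "v \<in> set (?own b)" "v \<in> set (?own c)" for b c v
    using that free uniq by (auto split: if_splits)
  have 5: "?rem b = n" if "?own b = []" for b
    using that unowned by (auto split: if_splits)
  have 6: "?rem b = 0" if "v \<in> U" "v \<notin> set (own a @ fr)" "\<forall>b. v \<notin> set (?own b)" "b \<in> set as" "R v b" for v b
  proof -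
    have "v \<noteq> u" using that(3) by (metis fun_upd_same list.set_intros(1))
    moreover have "v \<notin> set (own c)" for c
      using that(2,3) by (cases "c = a") (auto split: if_splits)
    ultimately have "rem b = 0" using that by (intro dropped [of v]) auto
    then show ?thesis by auto
  qed
  have 7: "?rem c \<le> ?rem b + 1" if "v \<in> set (?own b)" "c \<in> set as" "R v c" for b c v
  proof (cases "b = a")
    case True
    then show ?thesis using that a(3) [of c] by auto
  next
    case False
    then show ?thesis using that slack [of v b c] by auto
  qed
  show ?thesis
    unfolding auction_invariant_def
    by (intro conjI allI impI ballI; (elim 4)?; (fact 1 5 6)?) (use 1 2 3 5 6 7 in blast)+
qed

text \<open>
  With fewer owners than credit levels some level \<open>j\<close> is not taken by any owned item, and the bidders
  below that level form a set all of whose suitable items are owned within the set.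
\<close>

lemma auction_final:
  assumes inv: "auction_invariant R U n as [] rem own" and U: "finite U" "card U \<le> n"
  obtains W where "W \<subseteq> U" "\<And>u. u \<in> U \<Longrightarrow> (\<And>a. u \<notin> set (own a)) \<Longrightarrow> u \<in> W"
    "\<And>w a. w \<in> W \<Longrightarrow> a \<in> set as \<Longrightarrow> R w a \<Longrightarrow> \<exists>w'\<in>W. own a = [w']"
proof -
  have own: "own a = [] \<or> (\<exists>v. own a = [v])" for a
    using inv unfolding auction_invariant_def by (metis One_nat_def le_Suc_eq le_zero_eq length_0_conv length_Suc_conv)
  have uniq: "\<And>b c v. v \<in> set (own b) \<Longrightarrow> v \<in> set (own c) \<Longrightarrow> b = c"
    and cand: "\<And>b v. v \<in> set (own b) \<Longrightarrow> b \<in> set as \<and> v \<in> U \<and> R v b"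
    and unowned: "\<And>b. own b = [] \<Longrightarrow> rem b = n"
    and dropped: "\<And>v b. v \<in> U \<Longrightarrow> (\<And>b. v \<notin> set (own b)) \<Longrightarrow>
        b \<in> set as \<Longrightarrow> R v b \<Longrightarrow> rem b = 0"
    and slack: "\<And>b c v. v \<in> set (own b) \<Longrightarrow> c \<in> set as \<Longrightarrow> R v c \<Longrightarrow> rem c \<le> rem b + 1"
    using inv [unfolded auction_invariant_def list.set(1)] by blast+
  define P where "P = {u \<in> U. \<forall>a. u \<notin> set (own a)}"
  show thesis
  proof (cases "P = {}")
    case True
    then show thesis by (intro that [of "{}"]) (auto simp: P_def)
  next
    case False
    define E where "E = {a. own a \<noteq> []}"
    have hd: "hd (own a) \<in> set (own a)" if "a \<in> E" for a using that by (simp add: E_def)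
    \<comment> \<open>Sending each owned item to its owner is injective and misses the bidders in
      \<open>P\<close>, so owned items show fewer than \<open>n\<close> credit values.\<close>
    have "card E < card U"
    proof -
      have "inj_on (\<lambda>a. hd (own a)) E"
        by (rule inj_onI) (metis hd uniq)
      moreover have sub: "(\<lambda>a. hd (own a)) ` E \<subset> U"
        using hd cand False unfolding P_def by blast
      ultimately show ?thesis
        using psubset_card_mono [OF U(1) sub] by (simp add: card_image)
    qed
    moreover have "finite E"
      by (rule finite_subset [of _ "set as"]) (use hd cand in auto)
    ultimately have "card (rem ` E) < n" using U(2) card_image_le [of E rem] by linarith
    then have "\<not> {..<n} \<subseteq> rem ` E"
      using card_mono [of "rem ` E" "{..<n}"] \<open>finite E\<close> by auto
    then obtain j where j: "j < n" "j \<notin> rem ` E" by auto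
    \<comment> \<open>Unowned items have credit \<open>n > j\<close>, and no owned item has credit
      exactly \<open>j\<close>.\<close>
    have low: "own a \<noteq> [] \<and> rem a < j" if "rem a \<le> j" for a
    proof -
      have "own a \<noteq> []" using that j(1) unowned [of a] by auto
      then have "rem a \<noteq> j" using j(2) by (auto simp: E_def)
      then show ?thesis using that \<open>own a \<noteq> []\<close> by simp
    qed
    \<comment> \<open>The gap at \<open>j\<close> makes \<open>W\<close> closed: a suitable item of
      an owner below \<open>j\<close> has credit at most one higher, hence at most \<open>j\<close>,
      hence below \<open>j\<close> and owned. For bidders in \<open>P\<close> the credit is
      0.\<close>
    define W where "W = P \<union> {u. \<exists>a. u \<in> set (own a) \<and> rem a < j}"
    show thesis
    proof (rule that [of W])
      show "W \<subseteq> U" using cand by (auto simp: W_def P_def)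
      show "u \<in> W" if "u \<in> U" "\<And>a. u \<notin> set (own a)" for u
        using that by (auto simp: W_def P_def)
      fix w a assume w: "w \<in> W" "a \<in> set as" "R w a"
      have "rem a \<le> j"
      proof (cases "w \<in> P")
        case True
        then show ?thesis using dropped [of w a] w by (simp add: P_def)
      next
        case False
        then obtain b where "w \<in> set (own b)" "rem b < j" using w by (auto simp: W_def)
        then show ?thesis using slack [of w b a] w by simp
      qed
      then show "\<exists>w'\<in>W. own a = [w']" using low [of a] own [of a] by (auto simp: W_def)
    qed
  qed
qed

section \<open>The kernelization algorithm\<close>

type_synonym entry = "(nat \<times> nat) \<times> nat \<times> nat list"

text \<open>The initial entry of credit 0 stands for no candidate. As the comparison is strict, no
  item of credit 0 replaces it, and credit 0 in the result tells that the bidder is to be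
  dropped.\<close>

definition best_entry :: "(nat \<Rightarrow> nat \<times> nat \<Rightarrow> bool) \<Rightarrow> nat \<Rightarrow> entry list \<Rightarrow> entry" where
  "best_entry R u tab =
     fold (\<lambda>e b. if R u (fst e) \<and> fst (snd b) < fst (snd e) then e else b) tab ((0, 0), 0, [])"

definition auction_step ::
    "(nat \<Rightarrow> nat \<times> nat \<Rightarrow> bool) \<Rightarrow> nat list \<times> entry list \<Rightarrow> nat list \<times> entry list" where
  "auction_step R s = (case fst s of [] \<Rightarrow> s | u # us \<Rightarrow>
     if fst (snd (best_entry R u (snd s))) = 0 then (us, snd s)
     else (snd (snd (best_entry R u (snd s))) @ us,
       map (\<lambda>e. if fst e = fst (best_entry R u (snd s))
         then (fst e, fst (snd e) - 1, [u]) else e) (snd s)))"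

text \<open>Links the association list handled by the program with the functions \<open>rem\<close>
  and \<open>own\<close> of the invariant.\<close>

definition table :: "'a list \<Rightarrow> ('a \<Rightarrow> nat) \<Rightarrow> ('a \<Rightarrow> 'u list) \<Rightarrow> ('a \<times> nat \<times> 'u list) list" where
  "table as rem own = map (\<lambda>a. (a, rem a, own a)) as"

lemma best_entry_cases:
  obtains "\<And>a. a \<in> set as \<Longrightarrow> R u a \<Longrightarrow> rem a = 0" "fst (snd (best_entry R u (table as rem own))) = 0"
  | a where "a \<in> set as" "R u a" "\<And>b. b \<in> set as \<Longrightarrow> R u b \<Longrightarrow> rem b \<le> rem a"
    "best_entry R u (table as rem own) = (a, rem a, own a)" "rem a > 0"
proof -
  define f where "f e b = (if R u (fst e) \<and> fst (snd b) < fst (snd e) then e else b)" for e b :: entry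
  have fold: "fst (snd b) \<le> fst (snd (fold f es b)) \<and>
      (\<forall>e\<in>set es. R u (fst e) \<longrightarrow> fst (snd e) \<le> fst (snd (fold f es b))) \<and>
      (fold f es b = b \<or> fold f es b \<in> set es \<and> R u (fst (fold f es b)))" for es b
  proof (induction es arbitrary: b)
    case (Cons e es)
    have "fst (snd b) \<le> fst (snd (f e b))" "R u (fst e) \<longrightarrow> fst (snd e) \<le> fst (snd (f e b))"
      "f e b = b \<or> f e b = e \<and> R u (fst e)"
      by (auto simp: f_def)
    with Cons [of "f e b"] show ?case by force
  qed simp
  let ?b = "best_entry R u (table as rem own)"
  have b: "?b = fold f (table as rem own) ((0, 0), 0, [])"
    by (simp add: best_entry_def f_def [abs_def])
  have max: "rem a \<le> fst (snd ?b)" if "a \<in> set as" "R u a" for a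
    using fold [THEN conjunct2, THEN conjunct1, rule_format, of "(a, rem a, own a)" "table as rem own"] that
    unfolding b by (simp add: table_def)
  show thesis
  proof (cases "fst (snd ?b) = 0")
    case True
    then show thesis using that(1) max by fastforce
  next
    case False
    then have "?b \<in> set (table as rem own) \<and> R u (fst ?b)"
      using fold [where es = "table as rem own" and b = "((0, 0), 0, [])"]
      unfolding b [symmetric] by auto
    then obtain a where "a \<in> set as" "?b = (a, rem a, own a)" "R u a"
      by (auto simp: table_def)
    then show thesis using that(2) [of a] False max by auto
  qed
qed

text \<open>The number of waiting bidders plus the total credit is a potential: a drop removes a
  bidder, while an assignment returns at most one bidder for the one served and lowers the total
  credit.\<close>

lemma auction_step_table:
  assumes inv: "auction_invariant R U n as fr rem own" and dist: "distinct as"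
  obtains fr' rem' own' where
    "auction_step R (fr, table as rem own) = (fr', table as rem' own')"
    "auction_invariant R U n as fr' rem' own'"
    "fr \<noteq> [] \<Longrightarrow> length fr' + (\<Sum>a\<leftarrow>as. rem' a) < length fr + (\<Sum>a\<leftarrow>as. rem a)"
    "fr = [] \<Longrightarrow> fr' = []"
proof (cases fr)
  case Nil
  then show thesis using that [of fr rem own] inv by (simp add: auction_step_def)
next
  case (Cons u us)
  show thesis
  proof (rule best_entry_cases [of as R u rem own])
    assume *: "\<And>a. a \<in> set as \<Longrightarrow> R u a \<Longrightarrow> rem a = 0"
      "fst (snd (best_entry R u (table as rem own))) = 0"
    show thesis
      using auction_invariant_drop [OF inv [unfolded Cons] *(1)] *(2) Cons
      by (intro that [of us rem own]) (simp_all add: auction_step_def)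
  next
    fix a
    assume a: "a \<in> set as" "R u a" "\<And>b. b \<in> set as \<Longrightarrow> R u b \<Longrightarrow> rem b \<le> rem a"
      and best: "best_entry R u (table as rem own) = (a, rem a, own a)" and pos: "rem a > 0"
    show thesis
    proof (rule that [of "own a @ us" "rem(a := rem a - 1)" "own(a := [u])"])
      show "auction_step R (fr, table as rem own) =
          (own a @ us, table as (rem(a := rem a - 1)) (own(a := [u])))"
      proof -
        have "map (\<lambda>e. if fst e = a then (fst e, fst (snd e) - 1, [u]) else e) (table as rem own) =
            table as (rem(a := rem a - 1)) (own(a := [u]))"
          by (auto simp: table_def)
        then show ?thesis using pos by (simp add: auction_step_def Cons best)
      qed
      show "auction_invariant R U n as (own a @ us) (rem(a := rem a - 1)) (own(a := [u]))"
        by (rule auction_invariant_assign [OF inv [unfolded Cons] a])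
      have "length (own a) \<le> 1" using inv unfolding auction_invariant_def by blast
      moreover have "(\<Sum>b\<in>set as. (rem(a := rem a - 1)) b) < (\<Sum>b\<in>set as. rem b)"
        using a(1) pos by (intro sum_strict_mono_ex1) auto
      ultimately show "length (own a @ us) + (\<Sum>b\<leftarrow>as. (rem(a := rem a - 1)) b)
          < length fr + (\<Sum>b\<leftarrow>as. rem b)"
        using dist by (simp add: Cons sum_list_distinct_conv_sum_set)
    qed (use Cons in simp)
  qed
qed

text \<open>The list \<open>xs\<close> is a mere clock: with no bidder waiting the step is idle, so
  any list as long as the potential leads to the final state.\<close>

lemma fold_auction_step:
  assumes "auction_invariant R U n as fr rem own" "distinct as"
    and "length fr + (\<Sum>a\<leftarrow>as. rem a) \<le> length xs"
  obtains rem' own' where "fold (\<lambda>_. auction_step R) xs (fr, table as rem own) = ([], table as rem' own')"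
    "auction_invariant R U n as [] rem' own'"
  using assms(1,3)
proof (induction xs arbitrary: thesis fr rem own)
  case Nil
  then show ?case by simp
next
  case (Cons x xs)
  obtain fr' rem' own' where *:
    "auction_step R (fr, table as rem own) = (fr', table as rem' own')"
    "auction_invariant R U n as fr' rem' own'"
    "fr \<noteq> [] \<Longrightarrow> length fr' + (\<Sum>a\<leftarrow>as. rem' a) < length fr + (\<Sum>a\<leftarrow>as. rem a)"
    "fr = [] \<Longrightarrow> fr' = []"
    by (rule auction_step_table [OF Cons.prems(2) assms(2)]) (rule that)
  show ?case
  proof (cases "fr = []")
    case False
    with *(3) Cons.prems(3) have "length fr' + (\<Sum>a\<leftarrow>as. rem' a) \<le> length xs" by simp
    from Cons.IH [OF _ *(2) this] Cons.prems(1) *(1) show ?thesis by auto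
  next
    case True
    have "auction_step R ([], tab) = ([], tab)" for tab by (simp add: auction_step_def)
    then have "fold (\<lambda>_. auction_step R) ys ([], tab) = ([], tab)" for ys :: "'a list" and tab
      by (induction ys) simp_all
    with True Cons.prems(1,2) show ?thesis by blast
  qed
qed

section \<open>Packing, matching and kernel of a matrix\<close>

definition adjacent :: "bool list list \<Rightarrow> nat \<Rightarrow> nat \<Rightarrow> bool" where
  "adjacent m i j =
     (case drop i m of [] \<Rightarrow> False | r # _ \<Rightarrow> (case drop j r of [] \<Rightarrow> False | b # _ \<Rightarrow> b))"

definition is_triangle :: "bool list list \<Rightarrow> nat \<Rightarrow> nat \<times> nat \<Rightarrow> bool" where
  "is_triangle m u a \<longleftrightarrow>
     adjacent m u (fst a) \<and> adjacent m (fst a) (snd a) \<and> adjacent m (snd a) u"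

definition arcs_of :: "nat \<times> nat \<times> nat \<Rightarrow> (nat \<times> nat) list" where
  "arcs_of t = [(fst t, fst (snd t)), (fst (snd t), snd (snd t)), (snd (snd t), fst t)]"

definition share_arc :: "nat \<times> nat \<times> nat \<Rightarrow> nat \<times> nat \<times> nat \<Rightarrow> bool" where
  "share_arc s t \<longleftrightarrow> (\<exists>a\<in>set (arcs_of s). \<exists>b\<in>set (arcs_of t). a = b)"

definition vertices :: "bool list list \<Rightarrow> nat list" where
  "vertices m = [0..<length m]"

text \<open>All ordered pairs serve as items of the auction; \<open>is_triangle\<close> fails on a
  pair that is no arc, so such an item is never assigned.\<close>

definition arcs :: "bool list list \<Rightarrow> (nat \<times> nat) list" where
  "arcs m = List.product (vertices m) (vertices m)"

definition triples :: "bool list list \<Rightarrow> (nat \<times> nat \<times> nat) list" where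
  "triples m = List.product (vertices m) (arcs m)"

text \<open>One greedy pass is maximal, because a triple rejected for a shared arc stays blocked as
  the packing grows. Of the three rotations of a triangle at most one is taken, since they share
  arcs.\<close>

definition packing :: "bool list list \<Rightarrow> (nat \<times> nat \<times> nat) list" where
  "packing m = fold (\<lambda>t acc. if is_triangle m (fst t) (snd t) \<and> \<not> (\<exists>s\<in>set acc. share_arc s t)
     then t # acc else acc) (triples m) []"

definition covered :: "(nat \<times> nat \<times> nat) list \<Rightarrow> nat \<Rightarrow> bool" where
  "covered C v \<longleftrightarrow> (\<exists>t\<in>set C. v = fst t \<or> v = fst (snd t) \<or> v = snd (snd t))"

definition uncovered :: "bool list list \<Rightarrow> nat list" where
  "uncovered m = filter (\<lambda>v. \<not> covered (packing m) v) (vertices m)"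

text \<open>With \<open>n = length m\<close> there are at most \<open>n\<close> bidders, so credit
  \<open>n\<close> suffices for \<open>auction_final\<close>. The potential starts at no more than
  \<open>n + n * n ^ 2\<close>, and running twice through \<open>triples m\<close> gives
  \<open>2 * n ^ 3\<close> rounds.\<close>

definition auction :: "bool list list \<Rightarrow> nat list \<times> entry list" where
  "auction m = fold (\<lambda>_. auction_step (is_triangle m)) (triples m @ triples m)
     (uncovered m, map (\<lambda>a. (a, length m, [])) (arcs m))"

definition matched :: "bool list list \<Rightarrow> entry list" where
  "matched m = filter (\<lambda>e. snd (snd e) \<noteq> []) (snd (auction m))"

definition kernel_vertices :: "bool list list \<Rightarrow> nat list" where
  "kernel_vertices m = filter (\<lambda>v. covered (packing m) v \<or>
     (\<exists>e\<in>set (matched m). \<exists>u\<in>set (snd (snd e)). v = u)) (vertices m)"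

definition kernel_matrix :: "bool list list \<Rightarrow> bool list list" where
  "kernel_matrix m =
     map (\<lambda>i. map (\<lambda>j. adjacent m i j) (kernel_vertices m)) (kernel_vertices m)"

text \<open>The second component of an instance holds the sign and the digits of the budget.\<close>

definition kernelize ::
    "bool list list \<times> bool \<times> bool list \<Rightarrow> bool list list \<times> bool \<times> bool list" where
  "kernelize I = (if fst (snd I) then ([], snd I)
     else if le_digits (length (packing (fst I))) (snd (snd I)) \<and>
       le_digits (length (matched (fst I))) (snd (snd I))
     then (kernel_matrix (fst I), snd I)
     else ([], True, [True]))"

section \<open>Running time\<close>

abbreviation "enc_matrix \<equiv> enc_list (enc_list enc_bool)"
abbreviation "enc_arc \<equiv> enc_prod enc_nat enc_nat"
abbreviation "enc_triple \<equiv> enc_prod enc_nat enc_arc"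
abbreviation "enc_entry \<equiv> enc_prod enc_arc (enc_prod enc_nat (enc_list enc_nat))"
abbreviation "enc_raw \<equiv> enc_prod enc_matrix (enc_prod enc_bool (enc_list enc_bool))"

lemmas ptime_basic = ptime_fst ptime_snd ptime_id ptime_const ptime_Pair ptime_if ptime_conj
  ptime_disj ptime_not ptime_Cons ptime_null ptime_append ptime_eq_0 ptime_nat_less ptime_nat_eq
  ptime_length ptime_drop ptime_pred ptime_upt ptime_product ptime_le_digits

lemma ptime_adjacent:
  assumes "ptime c enc_matrix m" "ptime c enc_nat i" "ptime c enc_nat j"
  shows "ptime c enc_bool (\<lambda>x. adjacent (m x) (i x) (j x))"
proof (rule ptime_comp3 [OF _ assms])
  show "ptime (enc_prod enc_matrix (enc_prod enc_nat enc_nat)) enc_bool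
      (\<lambda>p. adjacent (fst p) (fst (snd p)) (snd (snd p)))"
    unfolding adjacent_def by (rule ptime_case_list ptime_basic)+
qed

lemma ptime_is_triangle:
  assumes "ptime c enc_matrix m" "ptime c enc_nat u" "ptime c enc_arc a"
  shows "ptime c enc_bool (\<lambda>x. is_triangle (m x) (u x) (a x))"
  unfolding is_triangle_def by (rule ptime_basic ptime_adjacent assms)+

lemma ptime_arc_eq:
  assumes "ptime c enc_arc a" "ptime c enc_arc b"
  shows "ptime c enc_bool (\<lambda>x. a x = b x)"
  unfolding prod_eq_iff by (rule ptime_basic assms)+

lemma ptime_share_arc:
  assumes "ptime c enc_triple s" "ptime c enc_triple t"
  shows "ptime c enc_bool (\<lambda>x. share_arc (s x) (t x))"
proof (rule ptime_comp2 [OF _ assms])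
  show "ptime (enc_prod enc_triple enc_triple) enc_bool (\<lambda>p. share_arc (fst p) (snd p))"
    unfolding share_arc_def arcs_of_def by (rule ptime_bex ptime_arc_eq ptime_basic)+
qed

lemma ptime_vertices:
  "ptime c enc_matrix m \<Longrightarrow> ptime c (enc_list enc_nat) (\<lambda>x. vertices (m x))"
  unfolding vertices_def by (rule ptime_basic | assumption)+

lemma ptime_arcs:
  "ptime c enc_matrix m \<Longrightarrow> ptime c (enc_list enc_arc) (\<lambda>x. arcs (m x))"
  unfolding arcs_def by (rule ptime_product ptime_vertices | assumption)+

lemma ptime_triples:
  "ptime c enc_matrix m \<Longrightarrow> ptime c (enc_list enc_triple) (\<lambda>x. triples (m x))"
  unfolding triples_def by (rule ptime_product ptime_vertices ptime_arcs | assumption)+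

lemma ptime_packing:
  assumes "ptime c enc_matrix m"
  shows "ptime c (enc_list enc_triple) (\<lambda>x. packing (m x))"
proof (rule ptime_comp [OF _ assms])
  have sub: "tsize (enc_list enc_triple (fold (\<lambda>t acc. if P t acc then t # acc else acc) ts acc))
      \<le> tsize (enc_list enc_triple ts) + tsize (enc_list enc_triple acc)" for P ts acc
  proof (induction ts arbitrary: acc)
    case (Cons t ts)
    show ?case using Cons [of "t # acc"] Cons [of acc] by auto
  qed simp
  show "ptime enc_matrix (enc_list enc_triple) packing"
    unfolding packing_def
  proof (rule ptime_fold)
    show "tsize (enc_list enc_triple (fold (\<lambda>t acc. if is_triangle m (fst t) (snd t) \<and>
        \<not> (\<exists>s\<in>set acc. share_arc s t) then t # acc else acc) (take n (triples m)) []))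
      \<le> tsize (enc_list enc_triple (triples m)) + 1" for m n
      using sub [of "\<lambda>t acc. is_triangle m (fst t) (snd t) \<and> \<not> (\<exists>s\<in>set acc. share_arc s t)"
          "take n (triples m)" "[]"] tsize_enc_list_take [of enc_triple n "triples m"] by simp
  qed (rule ptime_basic ptime_is_triangle ptime_bex ptime_share_arc ptime_triples
      pbounded_add pbounded_const pbounded_ptime)+
qed

lemma ptime_covered:
  assumes "ptime c (enc_list enc_triple) C" "ptime c enc_nat v"
  shows "ptime c enc_bool (\<lambda>x. covered (C x) (v x))"
proof (rule ptime_comp2 [OF _ assms])
  show "ptime (enc_prod (enc_list enc_triple) enc_nat) enc_bool (\<lambda>p. covered (fst p) (snd p))"
    unfolding covered_def by (rule ptime_bex ptime_basic)+
qed

lemma ptime_uncovered: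
  assumes "ptime c enc_matrix m"
  shows "ptime c (enc_list enc_nat) (\<lambda>x. uncovered (m x))"
proof (rule ptime_comp [OF _ assms])
  show "ptime enc_matrix (enc_list enc_nat) uncovered"
    unfolding uncovered_def
    by (rule ptime_filter ptime_covered ptime_packing ptime_vertices ptime_basic)+
qed

lemma ptime_best_entry:
  assumes "ptime c enc_matrix m" "ptime c enc_nat u" "ptime c (enc_list enc_entry) tab"
  shows "ptime c enc_entry (\<lambda>x. best_entry (is_triangle (m x)) (u x) (tab x))"
proof (rule ptime_comp3 [OF _ assms])
  let ?c = "enc_prod enc_matrix (enc_prod enc_nat (enc_list enc_entry))"
  let ?z = "((0, 0), 0, []) :: entry"
  show "ptime ?c enc_entry (\<lambda>p. best_entry (is_triangle (fst p)) (fst (snd p)) (snd (snd p)))"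
    unfolding best_entry_def
  proof (rule ptime_fold_invariant [where I = "\<lambda>p b. b = ?z \<or> b \<in> set (snd (snd p))"])
    show "tsize (enc_entry b) \<le> tsize (enc_entry ?z) + tsize (enc_list enc_entry (snd (snd p)))"
      if "b = ?z \<or> b \<in> set (snd (snd p))" for p :: "bool list list \<times> nat \<times> entry list" and b
      using that tsize_enc_list_member [of b "snd (snd p)" enc_entry] by (elim disjE) simp_all
    show "(if is_triangle (fst p) (fst (snd p)) (fst e) \<and> fst (snd b) < fst (snd e) then e else b) = ?z \<or>
        (if is_triangle (fst p) (fst (snd p)) (fst e) \<and> fst (snd b) < fst (snd e) then e else b)
          \<in> set (snd (snd p))"
      if "e \<in> set (snd (snd p))" "b = ?z \<or> b \<in> set (snd (snd p))"
      for p :: "bool list list \<times> nat \<times> entry list" and e b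
      using that by (simp split: if_split)
    show "?z = ?z \<or> ?z \<in> set (snd (snd p))" for p :: "bool list list \<times> nat \<times> entry list"
      by simp
  qed (rule ptime_basic ptime_is_triangle pbounded_add pbounded_const pbounded_ptime)+
qed

lemma ptime_auction_step:
  assumes "ptime c enc_matrix m" "ptime c (enc_prod (enc_list enc_nat) (enc_list enc_entry)) s"
  shows "ptime c (enc_prod (enc_list enc_nat) (enc_list enc_entry))
    (\<lambda>x. auction_step (is_triangle (m x)) (s x))"
proof (rule ptime_comp2 [OF _ assms])
  show "ptime (enc_prod enc_matrix (enc_prod (enc_list enc_nat) (enc_list enc_entry)))
    (enc_prod (enc_list enc_nat) (enc_list enc_entry)) (\<lambda>p. auction_step (is_triangle (fst p)) (snd p))"
    unfolding auction_step_def
    by (rule ptime_case_list ptime_map ptime_best_entry ptime_arc_eq ptime_basic)+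
qed

lemma uncovered_auction_invariant:
  "auction_invariant (is_triangle m) (set (uncovered m)) (length m) (arcs m) (uncovered m)
     (\<lambda>_. length m) (\<lambda>_. [])"
  by (auto simp: auction_invariant_def uncovered_def vertices_def)

lemma distinct_arcs: "distinct (arcs m)"
  by (simp add: arcs_def vertices_def distinct_product)

lemma uncovered_le: "set (uncovered m) \<subseteq> {..<length m}" "card (set (uncovered m)) \<le> length m"
proof -
  show "set (uncovered m) \<subseteq> {..<length m}" by (auto simp: uncovered_def vertices_def)
  then show "card (set (uncovered m)) \<le> length m" by (metis card_lessThan card_mono finite_lessThan)
qed

text \<open>The invariant keeps the queue distinct, the credits at most \<open>length m\<close> and
  the owner lists at most singletons. In unary notation an entry thus has linear size; the
  coefficients are rough.\<close>

lemma tsize_auction_state: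
  assumes inv: "auction_invariant R (set (uncovered m)) (length m) (arcs m) fr rem own"
  shows "tsize (enc_prod (enc_list enc_nat) (enc_list enc_entry) (fr, table (arcs m) rem own))
    \<le> (2 + length m * (2 * length m + 2)) + (1 + length m * length m * (10 * length m + 10))"
proof -
  have less: "u < length m" if "u \<in> set (uncovered m)" for u
    using that uncovered_le(1) by auto
  have fr: "distinct fr" "set fr \<subseteq> set (uncovered m)"
    using inv by (auto simp: auction_invariant_def)
  then have "length fr \<le> length m"
    using uncovered_le(2) [of m] card_mono [of "set (uncovered m)" "set fr"]
    by (simp add: distinct_card)
  moreover have "tsize (enc_list enc_nat fr) \<le> 1 + length fr * (1 + (2 * length m + 1))"
    by (rule tsize_enc_list_le) (use fr less in \<open>auto simp: tsize_enc_nat intro: less_imp_le\<close>)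
  moreover from \<open>length fr \<le> length m\<close>
  have "length fr * (1 + (2 * length m + 1)) \<le> length m * (1 + (2 * length m + 1))"
    by (rule mult_right_mono) simp
  ultimately have 1: "tsize (enc_list enc_nat fr) \<le> 1 + length m * (2 * length m + 2)"
    by simp
  have "tsize (enc_entry e) \<le> 10 * length m + 9" if "e \<in> set (table (arcs m) rem own)" for e
  proof -
    obtain a where a: "a \<in> set (arcs m)" "e = (a, rem a, own a)"
      using \<open>e \<in> _\<close> by (auto simp: table_def)
    have "fst a < length m" "snd a < length m" using a(1) by (auto simp: arcs_def vertices_def)
    moreover have "rem a \<le> length m" using inv unfolding auction_invariant_def by blast
    moreover have "tsize (enc_list enc_nat (own a)) \<le> 2 * length m + 3"
    proof (cases "own a")
      case (Cons u us)
      have "length (own a) \<le> 1" "u \<in> set (own a) \<longrightarrow> u \<in> set (uncovered m)"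
        using inv unfolding auction_invariant_def by blast+
      then have "us = []" "u \<in> set (uncovered m)" using Cons by simp_all
      then show ?thesis using less [of u] Cons by (simp add: tsize_enc_nat)
    qed simp
    ultimately show ?thesis using a(2) by (simp add: enc_prod_def tsize_enc_nat)
  qed
  from tsize_enc_list_le [of "table (arcs m) rem own" enc_entry, OF this]
  have "tsize (enc_list enc_entry (table (arcs m) rem own))
      \<le> 1 + length m * length m * (10 * length m + 10)"
    by (simp add: table_def arcs_def vertices_def add.commute)
  with 1 show ?thesis by (simp add: enc_prod_def)
qed

text \<open>The auction preserves its invariant on every list of rows, tournament or not, so the
  size bound is unconditional.\<close>

lemma ptime_auction:
  assumes "ptime c enc_matrix m"
  shows "ptime c (enc_prod (enc_list enc_nat) (enc_list enc_entry)) (\<lambda>x. auction (m x))"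
proof (rule ptime_comp [OF _ assms])
  let ?d = "enc_prod (enc_list enc_nat) (enc_list enc_entry)"
  let ?I = "\<lambda>m s. \<exists>fr rem own. s = (fr, table (arcs m) rem own) \<and>
      auction_invariant (is_triangle m) (set (uncovered m)) (length m) (arcs m) fr rem own"
  show "ptime enc_matrix ?d auction"
    unfolding auction_def
  proof (rule ptime_fold_invariant [where I = ?I])
    show "?I m (uncovered m, map (\<lambda>a. (a, length m, [])) (arcs m))" for m
      by (rule exI [of _ "uncovered m"], rule exI [of _ "\<lambda>_. length m"], rule exI [of _ "\<lambda>_. []"])
        (simp add: table_def uncovered_auction_invariant)
    show "?I m (auction_step (is_triangle m) s)" if "?I m s" for m s
    proof -
      from that obtain fr rem own where s: "s = (fr, table (arcs m) rem own)"
        and inv: "auction_invariant (is_triangle m) (set (uncovered m)) (length m) (arcs m) fr rem own"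
        by blast
      show ?thesis
        unfolding s by (rule auction_step_table [OF inv distinct_arcs]) blast
    qed
    show "tsize (?d s) \<le> (2 + tsize (enc_matrix m) * (2 * tsize (enc_matrix m) + 2))
        + (1 + tsize (enc_matrix m) * tsize (enc_matrix m) * (10 * tsize (enc_matrix m) + 10))"
      if "?I m s" for m s
    proof -
      have "tsize (?d s) \<le>
          (2 + length m * (2 * length m + 2)) + (1 + length m * length m * (10 * length m + 10))"
        using that tsize_auction_state by blast
      also have "\<dots> \<le> (2 + tsize (enc_matrix m) * (2 * tsize (enc_matrix m) + 2))
        + (1 + tsize (enc_matrix m) * tsize (enc_matrix m) * (10 * tsize (enc_matrix m) + 10))"
        using length_le_tsize [of m "enc_list enc_bool"] by (intro add_mono mult_mono) auto
      finally show ?thesis .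
    qed
  qed (rule ptime_auction_step ptime_triples ptime_uncovered ptime_arcs ptime_map ptime_basic
      pbounded_intros)+
qed

lemma ptime_matched:
  assumes "ptime c enc_matrix m"
  shows "ptime c (enc_list enc_entry) (\<lambda>x. matched (m x))"
proof (rule ptime_comp [OF _ assms])
  show "ptime enc_matrix (enc_list enc_entry) matched"
    unfolding matched_def by (rule ptime_filter ptime_auction ptime_basic)+
qed

lemma ptime_kernel_vertices:
  assumes "ptime c enc_matrix m"
  shows "ptime c (enc_list enc_nat) (\<lambda>x. kernel_vertices (m x))"
proof (rule ptime_comp [OF _ assms])
  show "ptime enc_matrix (enc_list enc_nat) kernel_vertices"
    unfolding kernel_vertices_def
    by (rule ptime_filter ptime_bex ptime_matched ptime_covered ptime_packing ptime_vertices
        ptime_basic)+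
qed

lemma ptime_kernel_matrix:
  assumes "ptime c enc_matrix m"
  shows "ptime c enc_matrix (\<lambda>x. kernel_matrix (m x))"
proof (rule ptime_comp [OF _ assms])
  show "ptime enc_matrix enc_matrix kernel_matrix"
    unfolding kernel_matrix_def
    by (rule ptime_map ptime_adjacent ptime_kernel_vertices ptime_basic)+
qed

lemma ptime_kernelize: "ptime enc_raw enc_raw kernelize"
  unfolding kernelize_def
  by (rule ptime_kernel_matrix ptime_packing ptime_matched ptime_basic)+

section \<open>Correctness\<close>

text \<open>The hypothesis makes both sides false outside the matrix, where \<open>adjacent\<close>
  defaults to \<open>False\<close>.\<close>

lemma adjacent_adjacency_matrix:
  assumes "A \<subseteq> {..<n} \<times> {..<n}"
  shows "adjacent (adjacency_matrix n A) i j \<longleftrightarrow> (i, j) \<in> A"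
proof -
  have drop: "drop i [0..<n] = (if i < n then i # [Suc i..<n] else [])" for i
    by (simp add: upt_conv_Cons)
  show ?thesis
    using assms by (auto simp: adjacent_def adjacency_matrix_def drop_map drop simp del: drop_upt)
qed

text \<open>Reflexivity of \<open>S\<close> lets an accepted element block itself, so acceptance and
  rejection give the same maximality claim. A new element is tested against earlier ones in one
  direction only, hence the disjunction in the last claim.\<close>

lemma fold_greedy:
  fixes S :: "'a \<Rightarrow> 'a \<Rightarrow> bool" and P :: "'a \<Rightarrow> bool"
  assumes "\<And>t. S t t"
  defines "f \<equiv> \<lambda>t acc. if P t \<and> \<not> (\<exists>s\<in>set acc. S s t) then t # acc else acc"
  shows "set acc \<subseteq> set (fold f ts acc)"
    and "t \<in> set (fold f ts acc) \<Longrightarrow> t \<in> set acc \<or> P t"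
    and "t \<in> set ts \<Longrightarrow> P t \<Longrightarrow> \<exists>s\<in>set (fold f ts acc). S s t"
    and "distinct acc \<Longrightarrow> distinct (fold f ts acc)"
    and "pairwise (\<lambda>s t. \<not> S s t \<or> \<not> S t s) (set acc) \<Longrightarrow>
      pairwise (\<lambda>s t. \<not> S s t \<or> \<not> S t s) (set (fold f ts acc))"
proof (induction ts arbitrary: acc)
  case (Cons a ts)
  have step: "set acc \<subseteq> set (f a acc)" "t \<in> set (f a acc) \<Longrightarrow> t \<in> set acc \<or> P t"
    "P a \<Longrightarrow> \<exists>s\<in>set (f a acc). S s a" "distinct acc \<Longrightarrow> distinct (f a acc)"
    "pairwise (\<lambda>s t. \<not> S s t \<or> \<not> S t s) (set acc) \<Longrightarrow>
      pairwise (\<lambda>s t. \<not> S s t \<or> \<not> S t s) (set (f a acc))" for t acc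
    using assms(1) by (auto simp: f_def pairwise_insert split: if_splits)
  have fold: "fold f (a # ts) acc = fold f ts (f a acc)" for acc by simp
  { case 1 show ?case unfolding fold using step(1) Cons.IH(1) by (rule order_trans) }
  { case 2 then show ?case unfolding fold using step(2) Cons.IH(2) by blast }
  { case 3 then show ?case unfolding fold set_simps insert_iff
      using step(3) Cons.IH(1,3) by blast }
  { case 4 then show ?case unfolding fold using step(4) Cons.IH(4) by blast }
  { case 5 then show ?case unfolding fold using step(5) Cons.IH(5) by blast }
qed auto

lemma set_arcs_of: "set (arcs_of (x, y, z)) = triangle_arcs x y z"
  by (simp add: arcs_of_def triangle_arcs_def)

lemma share_arc_iff: "share_arc s t \<longleftrightarrow> set (arcs_of s) \<inter> set (arcs_of t) \<noteq> {}"
  by (auto simp: share_arc_def)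

lemma packing_properties:
  shows packing_triangle: "t \<in> set (packing m) \<Longrightarrow> is_triangle m (fst t) (snd t)"
    and packing_maximal: "t \<in> set (triples m) \<Longrightarrow> is_triangle m (fst t) (snd t) \<Longrightarrow>
      \<exists>s\<in>set (packing m). share_arc s t"
    and distinct_packing: "distinct (packing m)"
    and packing_disjoint: "s \<in> set (packing m) \<Longrightarrow> t \<in> set (packing m) \<Longrightarrow> share_arc s t \<Longrightarrow> s = t"
proof -
  have refl: "share_arc t t" for t by (auto simp: share_arc_def arcs_of_def)
  note greedy = fold_greedy [where S = share_arc and ts = "triples m" and acc = "[]"
    and P = "\<lambda>t. is_triangle m (fst t) (snd t)", OF refl, folded packing_def]
  show "t \<in> set (packing m) \<Longrightarrow> is_triangle m (fst t) (snd t)" using greedy(2) [of t] by simp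
  show "t \<in> set (triples m) \<Longrightarrow> is_triangle m (fst t) (snd t) \<Longrightarrow>
      \<exists>s\<in>set (packing m). share_arc s t" using greedy(3) by blast
  show "distinct (packing m)" using greedy(4) by simp
  show "s \<in> set (packing m) \<Longrightarrow> t \<in> set (packing m) \<Longrightarrow> share_arc s t \<Longrightarrow> s = t"
    using greedy(5) share_arc_iff [of s t] share_arc_iff [of t s] by (auto simp: pairwise_def)
qed

lemma fast_triangle_packing_bound:
  assumes "fast A k" "distinct is" "\<And>i. i \<in> set is \<Longrightarrow> triangle A (a i) (b i) (c i)"
    and "\<And>i j. i \<in> set is \<Longrightarrow> j \<in> set is \<Longrightarrow>
      triangle_arcs (a i) (b i) (c i) \<inter> triangle_arcs (a j) (b j) (c j) \<noteq> {} \<Longrightarrow> i = j"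
  shows "int (length is) \<le> k"
proof -
  obtain F where F: "finite F" "int (card F) \<le> k" "acyclic (reverse_arcs F A)"
    using assms(1) unfolding fast_def by blast
  have "card (set is) \<le> card F"
    using F(1) acyclic_reverse_arcs_hits_triangle [OF F(3) assms(3)] assms(4)
    by (rule card_le_of_disjoint_hit)
  then show ?thesis using F(2) assms(2) by (simp add: distinct_card)
qed

text \<open>The claims share the analysis of \<open>U\<close> and of the final auction state. The
  equivalence holds for every budget, so the tests against \<open>k\<close> serve only the size
  bound.\<close>

lemma kernel_matrix_correct:
  fixes n :: nat and A :: "(nat \<times> nat) set" and k :: int
  assumes T: "tournament {..<n} A"
  defines "m \<equiv> adjacency_matrix n A"
  shows "fast A k \<Longrightarrow> int (length (packing m)) \<le> k"
    and "fast A k \<Longrightarrow> int (length (matched m)) \<le> k"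
    and "\<exists>B. tournament {..<length (kernel_vertices m)} B \<and>
      kernel_matrix m = adjacency_matrix (length (kernel_vertices m)) B \<and> (fast B k \<longleftrightarrow> fast A k)"
    and "length (kernel_vertices m) \<le> 3 * length (packing m) + length (matched m)"
proof -
  have AV: "A \<subseteq> {..<n} \<times> {..<n}" using T by (simp add: tournament_def)
  have len: "length m = n" by (simp add: m_def adjacency_matrix_def)
  have adj: "adjacent m i j \<longleftrightarrow> (i, j) \<in> A" for i j
    unfolding m_def by (rule adjacent_adjacency_matrix [OF AV])
  have tri: "is_triangle m u a \<longleftrightarrow> triangle A u (fst a) (snd a)" for u a
    by (simp add: is_triangle_def triangle_def adj)
  have vs: "set (vertices m) = {..<n}" by (auto simp: vertices_def len)
  have as: "set (arcs m) = {..<n} \<times> {..<n}" by (simp add: arcs_def vs)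

  show "int (length (packing m)) \<le> k" if "fast A k"
  proof (rule fast_triangle_packing_bound [OF that distinct_packing])
    show "triangle A (fst t) (fst (snd t)) (snd (snd t))" if "t \<in> set (packing m)" for t
      using packing_triangle [OF that] by (simp add: tri)
    show "s = t" if "s \<in> set (packing m)" "t \<in> set (packing m)"
      "triangle_arcs (fst s) (fst (snd s)) (snd (snd s)) \<inter>
       triangle_arcs (fst t) (fst (snd t)) (snd (snd t)) \<noteq> {}" for s t
      using that packing_disjoint [of s m t] by (simp add: share_arc_iff set_arcs_of [symmetric])
  qed

  define U where "U = set (uncovered m)"
  have U: "U = {v. v < n \<and> \<not> covered (packing m) v}"
    by (auto simp: U_def uncovered_def vs)
  \<comment> \<open>By maximality the triangle shares an arc with a packed one, and both ends of
    that arc are covered. Every arc of the triangle ends in \<open>x\<close> or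
    \<open>y\<close>.\<close>
  have UU: "y \<notin> U" if xyz: "triangle A x y z" "x \<in> U" for x y z
  proof
    assume "y \<in> U"
    have "(x, y, z) \<in> set (triples m)"
      using xyz(1) AV by (auto simp: triples_def vs as triangle_def)
    then obtain s where s: "s \<in> set (packing m)" "share_arc s (x, y, z)"
      using packing_maximal [of "(x, y, z)" m] xyz(1) by (auto simp: tri)
    then obtain a where "a \<in> set (arcs_of s)" "a \<in> triangle_arcs x y z"
      by (auto simp: share_arc_iff set_arcs_of)
    moreover from this(1) s(1) have "covered (packing m) (fst a)" "covered (packing m) (snd a)"
      by (auto simp: covered_def arcs_of_def)
    ultimately show False using \<open>y \<in> U\<close> \<open>x \<in> U\<close> by (auto simp: U triangle_arcs_def)
  qed

  have "n \<le> n * (n * n)" by (cases n) auto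
  moreover have "length (uncovered m) \<le> n"
    unfolding uncovered_def by (rule le_trans [OF length_filter_le]) (simp add: vertices_def len)
  ultimately have "length (uncovered m) \<le> n * (n * n)" by (rule le_trans [rotated])
  then have "length (uncovered m) + (\<Sum>a\<leftarrow>arcs m. length m) \<le> length (triples m @ triples m)"
    by (simp add: sum_list_triv triples_def arcs_def vertices_def len)
  from fold_auction_step [OF uncovered_auction_invariant distinct_arcs this]
  obtain rem own where auction: "auction m = ([], table (arcs m) rem own)"
    and inv: "auction_invariant (is_triangle m) U n (arcs m) [] rem own"
    unfolding auction_def table_def U_def len by blast
  have own1: "\<And>a. length (own a) \<le> 1"
    and cand: "\<And>a u. u \<in> set (own a) \<Longrightarrow> a \<in> set (arcs m) \<and> u \<in> U \<and> is_triangle m u a"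
    and uniq: "\<And>a b u. u \<in> set (own a) \<Longrightarrow> u \<in> set (own b) \<Longrightarrow> a = b"
    using inv unfolding auction_invariant_def by blast+
  have owner: "hd (own a) \<in> set (own a)" if "own a \<noteq> []" for a using that by simp
  define M where "M = filter (\<lambda>a. own a \<noteq> []) (arcs m)"
  have matched: "matched m = map (\<lambda>a. (a, rem a, own a)) M"
    by (simp add: matched_def auction table_def M_def filter_map comp_def)

  show "int (length (matched m)) \<le> k" if "fast A k"
  proof -
    have "int (length M) \<le> k"
    proof (rule fast_triangle_packing_bound [OF that])
      show "distinct M" by (simp add: M_def distinct_arcs)
      have tr: "hd (own e) \<in> U \<and> triangle A (hd (own e)) (fst e) (snd e)" if "e \<in> set M" for e
        using that cand [OF owner, of e] by (auto simp: M_def tri)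
      then show "triangle A (hd (own e)) (fst e) (snd e)" if "e \<in> set M" for e
        using that by blast
      fix e e' assume e: "e \<in> set M" "e' \<in> set M" and
        *: "triangle_arcs (hd (own e)) (fst e) (snd e) \<inter> triangle_arcs (hd (own e')) (fst e') (snd e') \<noteq> {}"
      \<comment> \<open>The apex lies in \<open>U\<close>, so neither end of the matched arc does;
        rotating the triangle covers the second end.\<close>
      have out: "fst e \<notin> U \<and> snd e \<notin> U" if "e \<in> set M" for e
        using tr [OF that] UU [of "hd (own e)" "fst e" "snd e"]
          UU [OF triangle_rotate [OF triangle_rotate], of "hd (own e)" "fst e" "snd e"] by blast
      have "hd (own e) = hd (own e') \<or> e = e'"
        using * out [OF e(1)] out [OF e(2)] tr [OF e(1)] tr [OF e(2)]
        by (cases e, cases e') (auto simp: triangle_arcs_def)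
      then show "e = e'"
        using uniq [OF owner [of e], of e'] owner [of e'] e by (auto simp: M_def)
    qed
    then show ?thesis by (simp add: matched)
  qed

  let ?X = "kernel_vertices m"
  have X: "set ?X = {v. v < n \<and> (covered (packing m) v \<or> (\<exists>a. v \<in> set (own a)))}"
    using cand by (fastforce simp: kernel_vertices_def vs matched M_def)
  have dX: "distinct ?X" by (simp add: kernel_vertices_def vertices_def)

  show "length ?X \<le> 3 * length (packing m) + length (matched m)"
  proof -
    \<comment> \<open>Three vertices for each packed triangle, and at most one owner for each
      matched arc.\<close>
    let ?L = "concat (map (\<lambda>t. [fst t, fst (snd t), snd (snd t)]) (packing m)) @ concat (map own M)"
    have "length ?X = card (set ?X)" using dX by (simp add: distinct_card)
    also have "\<dots> \<le> card (set ?L)"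
    proof (rule card_mono)
      show "set ?X \<subseteq> set ?L"
        using cand by (fastforce simp: X covered_def M_def)
    qed simp
    also have "\<dots> \<le> length ?L" by (rule card_length)
    also have "length (concat (map own M)) \<le> length M"
      using own1 by (induction M) (auto simp: add_mono, metis One_nat_def add_mono plus_1_eq_Suc)
    then have "length ?L \<le> 3 * length (packing m) + length (matched m)"
      by (simp add: length_concat comp_def sum_list_triv matched)
    finally show ?thesis .
  qed

  show "\<exists>B. tournament {..<length ?X} B \<and> kernel_matrix m = adjacency_matrix (length ?X) B \<and>
      (fast B k \<longleftrightarrow> fast A k)"
  proof (intro exI conjI iffI)
    let ?B = "{(i, j). i < length ?X \<and> j < length ?X \<and> (?X ! i, ?X ! j) \<in> A}"
    have Xn: "?X ! i \<in> {..<n}" if "i < length ?X" for i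
      using nth_mem [OF that] X by blast
    show "tournament {..<length ?X} ?B"
      unfolding tournament_def
    proof (intro conjI ballI impI)
      show "irrefl ?B" using T by (auto simp: tournament_def irrefl_def)
      fix i j assume ij: "i \<in> {..<length ?X}" "j \<in> {..<length ?X}" "i \<noteq> j"
      then have "?X ! i \<noteq> ?X ! j" using dX by (simp add: nth_eq_iff_index_eq)
      then have "((?X ! i, ?X ! j) \<in> A) \<noteq> ((?X ! j, ?X ! i) \<in> A)"
        using T Xn ij unfolding tournament_def by blast
      then show "((i, j) \<in> ?B) \<noteq> ((j, i) \<in> ?B)" using ij by simp
    qed auto
    have "kernel_matrix m =
        map (\<lambda>i. map (adjacent m i) (map ((!) ?X) [0..<length ?X])) (map ((!) ?X) [0..<length ?X])"
      unfolding kernel_matrix_def map_nth ..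
    then show "kernel_matrix m = adjacency_matrix (length ?X) ?B"
      by (simp add: adjacency_matrix_def adj comp_def)
    show "fast ?B k" if "fast A k"
      by (rule fast_pullback [OF that, where V = "{..<length ?X}" and h = "(!) ?X"])
        (use dX in \<open>auto simp: inj_on_def nth_eq_iff_index_eq\<close>)
    assume "fast ?B k"
    \<comment> \<open>The inverse of the numbering carries a solution of the kernel back to the
      subtournament on the kept vertices.\<close>
    define h where "h v = (THE i. i < length ?X \<and> ?X ! i = v)" for v
    have h: "h v < length ?X \<and> ?X ! h v = v" if "v \<in> set ?X" for v
      unfolding h_def by (rule theI') (use that dX in \<open>auto simp: in_set_conv_nth nth_eq_iff_index_eq\<close>)
    have fastX: "fast (A \<inter> set ?X \<times> set ?X) k"
    proof (rule fast_pullback [OF \<open>fast ?B k\<close>, where V = "set ?X" and h = h])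
      show "inj_on h (set ?X)" by (rule inj_onI) (metis h)
    qed (use h in auto)
    \<comment> \<open>This closed set supplies the partners: an arc forming a triangle with
      \<open>W\<close> has its owner in \<open>W\<close>, and owners belong to the kernel.\<close>
    obtain W where W: "W \<subseteq> U" "\<And>u. u \<in> U \<Longrightarrow> (\<And>a. u \<notin> set (own a)) \<Longrightarrow> u \<in> W"
      "\<And>w a. w \<in> W \<Longrightarrow> a \<in> set (arcs m) \<Longrightarrow> is_triangle m w a \<Longrightarrow> \<exists>w'\<in>W. own a = [w']"
      using auction_final [OF inv] uncovered_le(2) [of m] unfolding U_def len by blast
    show "fast A k"
    proof (rule fast_of_fast_restrict [OF T _ _ _ _ _ fastX, where W = W and f = "\<lambda>a. hd (own a)"])
      show "W \<subseteq> {..<n}" using W(1) U by auto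
      show "y \<notin> W" if "triangle A x y z" "x \<in> W" for x y z
        using UU that W(1) by blast
      have single: "\<exists>w'\<in>W. own (x, y) = [w']" if "w \<in> W" "triangle A w x y" for w x y
      proof (rule W(3) [OF that(1)])
        show "(x, y) \<in> set (arcs m)" using that(2) AV as by (auto simp: triangle_def)
        show "is_triangle m w (x, y)" using that(2) by (simp add: tri)
      qed
      show "hd (own (x, y)) \<in> W \<inter> set ?X \<and> triangle A (hd (own (x, y))) x y"
        if "w \<in> W" "triangle A w x y" for w x y
      proof -
        obtain w' where w': "w' \<in> W" "own (x, y) = [w']" using single \<open>w \<in> W\<close> \<open>triangle A w x y\<close> by blast
        then have "w' \<in> set (own (x, y))" by simp
        then have "w' \<in> U" "is_triangle m w' (x, y)" "w' \<in> set ?X"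
          using cand [of w' "(x, y)"] by (auto simp: X U)
        then show ?thesis using w' by (simp add: tri)
      qed
      show "(x, y) = (x', y')"
        if "w \<in> W" "triangle A w x y" "w' \<in> W" "triangle A w' x' y'"
          "hd (own (x, y)) = hd (own (x', y'))" for w x y w' x' y'
        using single [OF that(1,2)] single [OF that(3,4)] that(5) uniq
        by (metis list.sel(1) list.set_intros(1))
      \<comment> \<open>A vertex outside the kernel is uncovered and owns no arc, so it lies in
        \<open>W\<close>.\<close>
      show "{..<n} - W \<subseteq> set ?X" using W(2) by (auto simp: X U)
    qed
  qed
qed

section \<open>Kernelization of encoded instances\<close>

lemma enc_instance_raw:
  "enc_instance n A k = enc_raw (adjacency_matrix n A, k < 0, binary (nat \<bar>k\<bar>))"
  by (simp add: enc_instance_def enc_int_def enc_prod_def)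

lemma fast_nonneg: "fast A k \<Longrightarrow> 0 \<le> k"
  unfolding fast_def by auto

text \<open>A negative budget is answered by the empty tournament with the same budget; this is the
  case for which the size bound reads \<open>max 0 (4 * k)\<close>.\<close>

lemma kernelize_correct:
  fixes n :: nat and A :: "(nat \<times> nat) set" and k :: int
  assumes T: "tournament {..<n} A"
  shows "\<exists>n' A' k'.
      enc_raw (kernelize (adjacency_matrix n A, k < 0, binary (nat \<bar>k\<bar>))) = enc_instance n' A' k' \<and>
      tournament {..<n'} A' \<and> (fast A' k' \<longleftrightarrow> fast A k) \<and> k' \<le> k \<and> int n' \<le> max 0 (4 * k)"
proof -
  let ?m = "adjacency_matrix n A"
  have empty: "tournament {..<0::nat} {}" "adjacency_matrix 0 {} = []"
    by (simp_all add: tournament_def irrefl_def adjacency_matrix_def)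
  have le: "le_digits l (binary (nat k)) \<longleftrightarrow> int l \<le> k" if "0 \<le> k" for l
    using that by (auto simp: le_digits_binary)
  consider "k < 0" | "0 \<le> k" "int (length (packing ?m)) \<le> k" "int (length (matched ?m)) \<le> k"
    | "0 \<le> k" "\<not> (int (length (packing ?m)) \<le> k \<and> int (length (matched ?m)) \<le> k)"
    by linarith
  then show ?thesis
  proof cases
    case 1
    then have "\<not> fast B k" for B :: "(nat \<times> nat) set" using fast_nonneg [of B k] by auto
    then show ?thesis using 1 empty
      by (intro exI [of _ "0::nat"] exI [of _ "{}"] exI [of _ k]) (simp add: kernelize_def enc_instance_raw)
  next
    case 2
    obtain B where "tournament {..<length (kernel_vertices ?m)} B"
      "kernel_matrix ?m = adjacency_matrix (length (kernel_vertices ?m)) B" "fast B k \<longleftrightarrow> fast A k"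
      using kernel_matrix_correct(3) [OF T] by blast
    moreover have "int (length (kernel_vertices ?m)) \<le> 4 * k"
      using kernel_matrix_correct(4) [OF T] 2 by linarith
    ultimately show ?thesis using 2
      by (intro exI [of _ "length (kernel_vertices ?m)"] exI [of _ B] exI [of _ k])
        (simp add: kernelize_def enc_instance_raw le)
  next
    case 3
    then have "\<not> fast A k" using kernel_matrix_correct(1,2) [OF T] by blast
    moreover have "\<not> fast {} (-1)" using fast_nonneg [of "{}" "-1"] by auto
    \<comment> \<open>Sign \<open>True\<close> with digits \<open>[True]\<close> encodes the budget
      -1, which makes the empty tournament a no-instance and is below any \<open>k\<close> with
      \<open>0 \<le> k\<close>.\<close>
    moreover have "binary 1 = [True]" by (subst binary.simps) (simp add: binary.simps [of 0])
    ultimately show ?thesis using 3 empty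
      by (intro exI [of _ "0::nat"] exI [of _ "{}"] exI [of _ "-1"])
        (auto simp: kernelize_def enc_instance_raw le)
  qed
qed

theorem theorem1:
  "\<exists>(kernelize :: prog) (bound :: nat poly).
     \<forall>(n :: nat) (A :: (nat \<times> nat) set) (k :: int).
       tournament {..<n} A \<longrightarrow>
       (\<exists>(n' :: nat) (A' :: (nat \<times> nat) set) (k' :: int) (t :: nat).
          run kernelize (enc_instance n A k) (enc_instance n' A' k') t \<and>
          t \<le> poly bound (tsize (enc_instance n A k)) \<and>
          tournament {..<n'} A' \<and>
          (fast A' k' \<longleftrightarrow> fast A k) \<and>
          k' \<le> k \<and>
          int n' \<le> max 0 (4 * k))"
proof -
  obtain p q where p: "\<And>I. \<exists>t. run p (enc_raw I) (enc_raw (kernelize I)) t \<and> t \<le> poly q (tsize (enc_raw I))"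
    using ptime_kernelize by (rule ptimeE) (rule that)
  show ?thesis
  proof (intro exI [of _ p] exI [of _ q] allI impI)
    fix n :: nat and A :: "(nat \<times> nat) set" and k :: int
    assume "tournament {..<n} A"
    from kernelize_correct [OF this, of k] p [of "(adjacency_matrix n A, k < 0, binary (nat \<bar>k\<bar>))"]
    show "\<exists>(n' :: nat) (A' :: (nat \<times> nat) set) (k' :: int) (t :: nat).
          run p (enc_instance n A k) (enc_instance n' A' k') t \<and>
          t \<le> poly q (tsize (enc_instance n A k)) \<and>
          tournament {..<n'} A' \<and>
          (fast A' k' \<longleftrightarrow> fast A k) \<and>
          k' \<le> k \<and>
          int n' \<le> max 0 (4 * k)"
      unfolding enc_instance_raw [of n A k] by metis
  qed
qed

end
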